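(* Let $d>1$ be an integer and let $m,t$ be positive integers such that $t$ divides $m$, and let $\theta:\mathbb{D}^d\to\theta(\mathbb{D}^d)$ be the basic polynomial map associated to the group $G(m,t,d)$. The (norm-)closed algebra generated by the inner functions in $H^\infty(\theta(\mathbb{D}^d))$ is a proper subalgebra of $H^\infty(\theta(\mathbb{D}^d))$.
   Context: $\mathbb{D}$ is the open unit disc, $\mathbb{T}$ the unit circle. The map $\theta=(\theta_1,\dots,\theta_d)$ is given by $\theta_j(\boldsymbol z)=E_j(z_1^m,\dots,z_d^m)$ for $1\le j\le d-1$ and $\theta_d(\boldsymbol z)=(z_1\cdots z_d)^{m/t}$, where $E_j$ is the $j$-th elementary symmetric polynomial in $d$ variables. ($G(m,t,d)$ is the group of maps $\boldsymbol z\mapsto(\alpha^{\nu_1}z_{\sigma(1)},\dots,\alpha^{\nu_d}z_{\sigma(d)})$ with $\alpha=e^{2\pi i/m}$, $\sigma\in S_d$ and integers $\nu_1,\dots,\nu_d$ whose sum is divisible by $t$; $\theta(\mathbb{D}^d)$ is a domain in $\mathbb{C}^d$ biholomorphic to $\mathbb{D}^d/G(m,t,d)$.) $H^\infty(\theta(\mathbb{D}^d))$ is the Banach algebra of bounded holomorphic functions on $\theta(\mathbb{D}^d)$ with the sup norm. Write $\partial\theta(\mathbb{D}^d)=\theta(\mathbb{T}^d)$, and let $\mu$ be the push-forward under $\theta$ of the normalized Haar measure $\nu$ on $\mathbb{T}^d$. Each $f\in H^\infty(\theta(\mathbb{D}^d))$ has a boundary function $f^*(\boldsymbol q)=\lim_{r\to1^-}f(r^mq_1,r^{2m}q_2,\dots,r^{(d-1)m}q_{d-1},r^{dm/t}q_d)$,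 defined for $\mu$-almost every $\boldsymbol q\in\partial\theta(\mathbb{D}^d)$. A function $f\in H^\infty(\theta(\mathbb{D}^d))$ is called inner if $|f^*|=1$ $\mu$-almost everywhere on $\partial\theta(\mathbb{D}^d)$. *)

theory Defs
  imports "HOL-Analysis.Analysis"
begin

text \<open>
  Vectors in \<open>d\<close>-dimensional complex space are elements of \<open>complex ^ 'n\<close> with \<open>d = CARD('n)\<close>.
  Since the components of \<open>theta\<close> play different roles, a numbering \<open>ix\<close> of the
  coordinates, i.e. a bijection from \<open>'n\<close> onto \<open>{1..d}\<close>, is carried along as a parameter.
\<close>

definition polydisc :: "(complex ^ 'n::finite) set" where
  "polydisc = {z. \<forall>i. norm (z $ i) < 1}"

definition elem_sym :: "nat \<Rightarrow> complex ^ 'n::finite \<Rightarrow> complex" where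
  "elem_sym j z = (\<Sum>S | card S = j. \<Prod>i\<in>S. z $ i)"

definition theta :: "('n::finite \<Rightarrow> nat) \<Rightarrow> nat \<Rightarrow> nat \<Rightarrow> complex ^ 'n \<Rightarrow> complex ^ 'n" where
  "theta ix m t z =
     (\<chi> k. if ix k = CARD('n) then (\<Prod>i\<in>UNIV. z $ i) ^ (m div t)
           else elem_sym (ix k) (\<chi> i. (z $ i) ^ m))"

definition theta_domain :: "('n::finite \<Rightarrow> nat) \<Rightarrow> nat \<Rightarrow> nat \<Rightarrow> (complex ^ 'n) set" where
  "theta_domain ix m t = theta ix m t ` polydisc"

text \<open>Complex differentiability at every point: the real derivative is complex linear.\<close>

definition holomorphic_several :: "(complex ^ 'n::finite \<Rightarrow> complex) \<Rightarrow> (complex ^ 'n) set \<Rightarrow> bool" where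
  "holomorphic_several f \<Omega> \<longleftrightarrow>
     (\<forall>z\<in>\<Omega>. \<exists>D. (f has_derivative D) (at z) \<and> (\<forall>c v. D (c *s v) = c * D v))"

text \<open>
  A function on \<open>\<Omega>\<close> is represented by its extension by zero, so that equality in \<open>Hinf \<Omega>\<close>
  is equality on \<open>\<Omega>\<close>; the unit of the algebra is then the indicator function of \<open>\<Omega>\<close>.
\<close>

definition Hinf :: "(complex ^ 'n::finite) set \<Rightarrow> (complex ^ 'n \<Rightarrow> complex) set" where
  "Hinf \<Omega> = {f. holomorphic_several f \<Omega> \<and> bounded (f ` \<Omega>) \<and> (\<forall>z. z \<notin> \<Omega> \<longrightarrow> f z = 0)}"

definition sup_norm :: "(complex ^ 'n::finite) set \<Rightarrow> (complex ^ 'n \<Rightarrow> complex) \<Rightarrow> real" where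
  "sup_norm \<Omega> f = (SUP z\<in>\<Omega>. norm (f z))"

definition Hinf_subalgebra ::
  "(complex ^ 'n::finite) set \<Rightarrow> (complex ^ 'n \<Rightarrow> complex) set \<Rightarrow> bool" where
  "Hinf_subalgebra \<Omega> B \<longleftrightarrow>
     B \<subseteq> Hinf \<Omega> \<and> indicator \<Omega> \<in> B \<and>
     (\<forall>f\<in>B. \<forall>g\<in>B. (\<lambda>z. f z + g z) \<in> B) \<and>
     (\<forall>f\<in>B. \<forall>g\<in>B. (\<lambda>z. f z * g z) \<in> B) \<and>
     (\<forall>c. \<forall>f\<in>B. (\<lambda>z. c * f z) \<in> B)"

definition Hinf_norm_closed ::
  "(complex ^ 'n::finite) set \<Rightarrow> (complex ^ 'n \<Rightarrow> complex) set \<Rightarrow> bool" where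
  "Hinf_norm_closed \<Omega> B \<longleftrightarrow>
     (\<forall>f\<in>Hinf \<Omega>. (\<forall>\<epsilon>>0. \<exists>g\<in>B. sup_norm \<Omega> (\<lambda>z. f z - g z) < \<epsilon>) \<longrightarrow> f \<in> B)"

definition closed_algebra_generated ::
  "(complex ^ 'n::finite) set \<Rightarrow> (complex ^ 'n \<Rightarrow> complex) set \<Rightarrow> (complex ^ 'n \<Rightarrow> complex) set" where
  "closed_algebra_generated \<Omega> A = \<Inter>{B. Hinf_subalgebra \<Omega> B \<and> Hinf_norm_closed \<Omega> B \<and> A \<subseteq> B}"

text \<open>
  Normalized Haar measure of the torus, as a Borel measure on the whole space concentrated on the
  torus: the image of Lebesgue measure on the unit cube under \<open>x \<mapsto> (exp (2 \<pi> \<i> x\<^sub>i))\<^sub>i\<close>.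
\<close>

definition haar_torus :: "(complex ^ 'n::finite) measure" where
  "haar_torus =
     distr (restrict_space lborel (cbox (0 :: real ^ 'n) (\<chi> i. 1))) borel
       (\<lambda>x. \<chi> i. cis (2 * pi * (x $ i)))"

definition theta_measure :: "('n::finite \<Rightarrow> nat) \<Rightarrow> nat \<Rightarrow> nat \<Rightarrow> (complex ^ 'n) measure" where
  "theta_measure ix m t = distr haar_torus borel (theta ix m t)"

definition theta_dilate ::
  "('n::finite \<Rightarrow> nat) \<Rightarrow> nat \<Rightarrow> nat \<Rightarrow> real \<Rightarrow> complex ^ 'n \<Rightarrow> complex ^ 'n" where
  "theta_dilate ix m t r q =
     (\<chi> k. if ix k = CARD('n) then of_real (r ^ (CARD('n) * (m div t))) * q $ k
           else of_real (r ^ (ix k * m)) * q $ k)"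

definition has_boundary_value ::
  "('n::finite \<Rightarrow> nat) \<Rightarrow> nat \<Rightarrow> nat \<Rightarrow> (complex ^ 'n \<Rightarrow> complex) \<Rightarrow> complex ^ 'n \<Rightarrow> complex \<Rightarrow> bool" where
  "has_boundary_value ix m t f q l \<longleftrightarrow> ((\<lambda>r. f (theta_dilate ix m t r q)) \<longlongrightarrow> l) (at_left 1)"

definition inner_functions ::
  "('n::finite \<Rightarrow> nat) \<Rightarrow> nat \<Rightarrow> nat \<Rightarrow> (complex ^ 'n \<Rightarrow> complex) set" where
  "inner_functions ix m t =
     {f \<in> Hinf (theta_domain ix m t).
        AE q in theta_measure ix m t. \<exists>l. has_boundary_value ix m t f q l \<and> norm l = 1}"

end

theory Submission
  imports Defs "HOL-Complex_Analysis.Conformal_Mappings"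
    "HOL-Computational_Algebra.Fundamental_Theorem_Algebra"
begin

text \<open>
  If \<open>f\<close> is a finite sum \<open>\<Sum> c\<^sub>k g\<^sub>k\<close> of inner functions and \<open>G = \<Prod> g\<^sub>k\<close>, then \<open>G\<close> times the complex
  conjugate of \<open>f\<close> has on the torus the boundary values of a bounded holomorphic function. Hence
  for \<open>f\<close> in the closed algebra and \<open>\<epsilon> > 0\<close> there are bounded holomorphic \<open>G\<close>, \<open>h\<close> with \<open>|G| = 1\<close> and
  \<open>|h - G cnj f| \<le> \<epsilon>\<close> on the torus, so \<open>F = 4 G - f h\<close> is holomorphic with \<open>|F|\<close> close to
  \<open>|4 - |f|\<^sup>2|\<close>. If a holomorphic function is bounded by a constant on the boundaries of a dense set
  of slices \<open>c \<mapsto> \<theta> (c w)\<close>, it is bounded by this constant everywhere. It therefore suffices to find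
  \<open>f\<close> with \<open>|f| = 2 powr U\<close> a.e. on the torus, where \<open>U\<close> is constant on slices, at least \<open>9/10\<close> near
  a dense set of slices, and at most \<open>1/10\<close> on a set of positive measure.

  With \<open>x\<^sub>i = z\<^sub>i\<^sup>m\<close>, the functions \<open>s = E\<^sub>d(x)\<close> and \<open>v = E\<^sub>1(x) E\<^sub>d\<^sub>-\<^sub>1(x) / 4\<^sup>d\<close> are holomorphic on the domain and
  have the same degree, and \<open>y = v / s = |E\<^sub>1(x)|\<^sup>2 / 4\<^sup>d\<close> on the torus is constant on slices. For a real
  polynomial \<open>u \<ge> 0\<close> of degree at most \<open>N\<close> the function \<open>-2 s\<^sup>N u(v / s) / (1 - s\<^sup>N)\<close> is holomorphic,
  with real part \<open>u(y)\<close> a.e. on the torus and at most \<open>u(y)\<close> inside each slice. Summing such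
  functions over a series \<open>U = \<Sum> u\<^sub>j(y) \<le> 1\<close>, with \<open>N\<^sub>j\<close> growing fast, and exponentiating gives \<open>f\<close>.
\<close>

section \<open>Holomorphic functions of several variables\<close>

lemma norm_vector_smult: "norm (c *s v) = norm c * norm (v :: complex ^ 'n::finite)"
  by (simp add: norm_vec_def vector_scalar_mult_def norm_mult L2_set_right_distrib)

lemma holomorphic_severalI:
  assumes "\<And>z. z \<in> \<Omega> \<Longrightarrow> (f has_derivative D z) (at z)"
    and "\<And>z c v. z \<in> \<Omega> \<Longrightarrow> D z (c *s v) = c * D z v"
  shows "holomorphic_several f \<Omega>"
  using assms unfolding holomorphic_several_def by blast

lemma holomorphic_severalE:
  assumes "holomorphic_several f \<Omega>"
  obtains D where "\<And>z. z \<in> \<Omega> \<Longrightarrow> (f has_derivative D z) (at z)"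
    and "\<And>z c v. z \<in> \<Omega> \<Longrightarrow> D z (c *s v) = c * D z v"
  using assms unfolding holomorphic_several_def by metis

lemma holomorphic_several_const: "holomorphic_several (\<lambda>z. c) \<Omega>"
  by (rule holomorphic_severalI[where D = "\<lambda>_ _. 0"]) auto

lemma holomorphic_several_nth: "holomorphic_several (\<lambda>z. z $ k) \<Omega>"
  by (rule holomorphic_severalI[where D = "\<lambda>_ v. v $ k"])
     (auto intro!: bounded_linear_imp_has_derivative bounded_linear_vec_nth)

lemma holomorphic_several_add:
  assumes "holomorphic_several f \<Omega>" "holomorphic_several g \<Omega>"
  shows "holomorphic_several (\<lambda>z. f z + g z) \<Omega>"
proof -
  obtain D where D: "\<And>z. z \<in> \<Omega> \<Longrightarrow> (f has_derivative D z) (at z)"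
    "\<And>z c v. z \<in> \<Omega> \<Longrightarrow> D z (c *s v) = c * D z v"
    using holomorphic_severalE[OF assms(1)] by metis
  obtain E where E: "\<And>z. z \<in> \<Omega> \<Longrightarrow> (g has_derivative E z) (at z)"
    "\<And>z c v. z \<in> \<Omega> \<Longrightarrow> E z (c *s v) = c * E z v"
    using holomorphic_severalE[OF assms(2)] by metis
  show ?thesis
    by (rule holomorphic_severalI[where D = "\<lambda>z v. D z v + E z v"])
       (auto simp: D E algebra_simps intro!: has_derivative_add)
qed

lemma holomorphic_several_mult:
  assumes "holomorphic_several f \<Omega>" "holomorphic_several g \<Omega>"
  shows "holomorphic_several (\<lambda>z. f z * g z) \<Omega>"
proof -
  obtain D where D: "\<And>z. z \<in> \<Omega> \<Longrightarrow> (f has_derivative D z) (at z)"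
    "\<And>z c v. z \<in> \<Omega> \<Longrightarrow> D z (c *s v) = c * D z v"
    using holomorphic_severalE[OF assms(1)] by metis
  obtain E where E: "\<And>z. z \<in> \<Omega> \<Longrightarrow> (g has_derivative E z) (at z)"
    "\<And>z c v. z \<in> \<Omega> \<Longrightarrow> E z (c *s v) = c * E z v"
    using holomorphic_severalE[OF assms(2)] by metis
  show ?thesis
    by (rule holomorphic_severalI[where D = "\<lambda>z v. f z * E z v + D z v * g z"])
       (rule has_derivative_mult, simp_all add: D E algebra_simps)
qed

lemma holomorphic_several_compose:
  assumes "holomorphic_several f \<Omega>"
    and "\<And>z. z \<in> \<Omega> \<Longrightarrow> (\<phi> has_field_derivative \<phi>' z) (at (f z))"
  shows "holomorphic_several (\<lambda>z. \<phi> (f z)) \<Omega>"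
proof -
  obtain D where D: "\<And>z. z \<in> \<Omega> \<Longrightarrow> (f has_derivative D z) (at z)"
    "\<And>z c v. z \<in> \<Omega> \<Longrightarrow> D z (c *s v) = c * D z v"
    using holomorphic_severalE[OF assms(1)] by metis
  show ?thesis
  proof (rule holomorphic_severalI[where D = "\<lambda>z v. \<phi>' z * D z v"])
    fix z assume "z \<in> \<Omega>"
    then show "((\<lambda>z. \<phi> (f z)) has_derivative (\<lambda>v. \<phi>' z * D z v)) (at z)"
      using has_derivative_compose[OF D(1)] assms(2)[unfolded has_field_derivative_def] by metis
  qed (simp add: D)
qed

lemma holomorphic_several_power:
  assumes "holomorphic_several f \<Omega>" shows "holomorphic_several (\<lambda>z. f z ^ n) \<Omega>"
  using assms by (rule holomorphic_several_compose) (auto intro!: derivative_eq_intros)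

lemma holomorphic_several_exp:
  assumes "holomorphic_several f \<Omega>" shows "holomorphic_several (\<lambda>z. exp (f z)) \<Omega>"
  using assms by (rule holomorphic_several_compose) (auto intro!: derivative_eq_intros)

lemma holomorphic_several_inverse:
  assumes "holomorphic_several f \<Omega>" "\<And>z. z \<in> \<Omega> \<Longrightarrow> f z \<noteq> 0"
  shows "holomorphic_several (\<lambda>z. inverse (f z)) \<Omega>"
  using assms(1) by (rule holomorphic_several_compose) (auto intro!: derivative_eq_intros assms(2))

lemma holomorphic_several_sum:
  assumes "\<And>i. i \<in> I \<Longrightarrow> holomorphic_several (f i) \<Omega>"
  shows "holomorphic_several (\<lambda>z. \<Sum>i\<in>I. f i z) \<Omega>"
  using assms
  by (induction I rule: infinite_finite_induct)
     (auto intro: holomorphic_several_const holomorphic_several_add)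

lemma holomorphic_several_diff:
  assumes "holomorphic_several f \<Omega>" "holomorphic_several g \<Omega>"
  shows "holomorphic_several (\<lambda>z. f z - g z) \<Omega>"
  using holomorphic_several_add[OF assms(1)
      holomorphic_several_mult[OF holomorphic_several_const[of "-1"] assms(2)]] by simp

lemma holomorphic_several_subset:
  "holomorphic_several f \<Omega> \<Longrightarrow> \<Omega>' \<subseteq> \<Omega> \<Longrightarrow> holomorphic_several f \<Omega>'"
  unfolding holomorphic_several_def by blast

lemma holomorphic_several_cong:
  assumes "holomorphic_several f \<Omega>" "open \<Omega>" "\<And>z. z \<in> \<Omega> \<Longrightarrow> f z = g z"
  shows "holomorphic_several g \<Omega>"
  using assms unfolding holomorphic_several_def
  by (metis has_derivative_transform_within_open)

lemma holomorphic_several_imp_continuous_on: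
  "holomorphic_several f \<Omega> \<Longrightarrow> continuous_on \<Omega> f"
  unfolding holomorphic_several_def
  by (meson continuous_at_imp_continuous_on has_derivative_continuous)

section \<open>Holomorphic curves and uniformly convergent series\<close>

lemma has_derivative_vec:
  assumes "\<And>k. ((\<lambda>x. f k x) has_derivative f' k) (at x within S)"
  shows "((\<lambda>x. \<chi> k. f k x :: complex ^ 'n::finite) has_derivative (\<lambda>h. \<chi> k. f' k h)) (at x within S)"
  unfolding has_derivative_componentwise_within[where f = "\<lambda>x. \<chi> k. f k x"]
proof
  fix i :: "complex ^ 'n" assume "i \<in> Basis"
  then obtain k b where i: "i = axis k b" "b \<in> Basis"
    by (auto simp: Basis_vec_def)
  show "((\<lambda>x. (\<chi> k. f k x) \<bullet> i) has_derivative (\<lambda>x. (\<chi> k. f' k x) \<bullet> i)) (at x within S)"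
    unfolding i inner_axis vec_lambda_beta
    by (intro has_derivative_inner_left assms)
qed

text \<open>The chain rule gives the derivative \<open>h \<mapsto> D (h *s w)\<close>, and complex
  linearity of \<open>D\<close> turns it into multiplication by \<open>D w\<close>. One-variable
  function theory thus becomes available on slices and in single coordinates.\<close>

lemma holomorphic_several_along:
  assumes f: "holomorphic_several f \<Omega>" and "open S"
    and \<gamma>: "\<And>k. (\<lambda>l. \<gamma> l $ k) holomorphic_on S" and sub: "\<And>l. l \<in> S \<Longrightarrow> \<gamma> l \<in> \<Omega>"
  shows "(\<lambda>l. f (\<gamma> l)) holomorphic_on S"
proof -
  obtain D where D: "\<And>z. z \<in> \<Omega> \<Longrightarrow> (f has_derivative D z) (at z)"
    "\<And>z c v. z \<in> \<Omega> \<Longrightarrow> D z (c *s v) = c * D z v"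
    using holomorphic_severalE[OF f] by metis
  have "\<exists>d. ((\<lambda>l. f (\<gamma> l)) has_field_derivative d) (at l)" if l: "l \<in> S" for l
  proof -
    have "\<And>k. ((\<lambda>l. \<gamma> l $ k) has_field_derivative deriv (\<lambda>l. \<gamma> l $ k) l) (at l)"
      using \<gamma> \<open>open S\<close> l by (meson holomorphic_derivI)
    then have "((\<lambda>l. \<chi> k. \<gamma> l $ k) has_derivative (\<lambda>h. \<chi> k. deriv (\<lambda>l. \<gamma> l $ k) l * h)) (at l)"
      by (intro has_derivative_vec) (simp add: has_field_derivative_def)
    then have "(\<gamma> has_derivative (\<lambda>h. h *s (\<chi> k. deriv (\<lambda>l. \<gamma> l $ k) l))) (at l)"
      by (simp add: vector_scalar_mult_def mult.commute)
    from has_derivative_compose[OF this D(1)[OF sub[OF l]]]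
    have "((\<lambda>l. f (\<gamma> l)) has_field_derivative D (\<gamma> l) (\<chi> k. deriv (\<lambda>l. \<gamma> l $ k) l)) (at l)"
      by (simp add: has_field_derivative_def D(2)[OF sub[OF l]] mult_commute_abs)
    then show ?thesis by blast
  qed
  then show ?thesis
    using holomorphic_on_open[OF \<open>open S\<close>] by blast
qed

text \<open>Weierstrass' theorem. Cauchy's inequality on complex lines bounds the differentials of
  the terms by multiples of \<open>M j\<close>, uniformly near \<open>z\<close>, so the series may
  be differentiated term by term.\<close>

lemma holomorphic_several_suminf:
  assumes "open \<Omega>" and f: "\<And>j. holomorphic_several (f j) \<Omega>"
    and bound: "\<And>j z. z \<in> \<Omega> \<Longrightarrow> norm (f j z) \<le> M j" and M: "summable M"
  shows "holomorphic_several (\<lambda>z. \<Sum>j. f j z) \<Omega>"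
proof -
  have "\<exists>D. \<forall>z\<in>\<Omega>. (f j has_derivative D z) (at z) \<and> (\<forall>c v. D z (c *s v) = c * D z v)" for j
    using holomorphic_severalE[OF f] by metis
  then obtain D where D: "\<And>j z. z \<in> \<Omega> \<Longrightarrow> (f j has_derivative D j z) (at z)"
    "\<And>j z c v. z \<in> \<Omega> \<Longrightarrow> D j z (c *s v) = c * D j z v"
    by metis
  show ?thesis
    unfolding holomorphic_several_def
  proof
    fix z assume z: "z \<in> \<Omega>"
    then obtain r0 where "r0 > 0" "ball z r0 \<subseteq> \<Omega>"
      using \<open>open \<Omega>\<close> openE by blast
    \<comment> \<open>Halving leaves room: a ball of radius \<open>r\<close> around any point of
      \<open>ball z r\<close> still lies in \<open>\<Omega>\<close>.\<close>
    define r where "r = r0 / 2"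
    have r: "r > 0" "ball z (2 * r) \<subseteq> \<Omega>"
      using \<open>r0 > 0\<close> \<open>ball z r0 \<subseteq> \<Omega>\<close> by (auto simp: r_def)
    have Dbound: "norm (D j x v) \<le> 2 * M j / r * norm v" if x: "x \<in> ball z r" for j x v
    proof (cases "v = 0")
      case True
      have "x \<in> \<Omega>" using x r by (auto simp: subset_iff)
      then have "D j x 0 = 0" using D(2)[of x j 0 0] by simp
      then show ?thesis using True by simp
    next
      case False
      \<comment> \<open>Chosen so that the complex disc of radius \<open>2 * \<rho>\<close> in
        direction \<open>v\<close> around \<open>x\<close> moves \<open>x\<close> by less than
        \<open>r\<close>. The Cauchy estimate is taken on the circle of half that radius, which lies
        well inside.\<close>
      define \<rho> where "\<rho> = r / (2 * norm v)"
      have \<rho>: "\<rho> > 0" "2 * \<rho> * norm v = r" using False r by (auto simp: \<rho>_def)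
      have inO: "x + l *s v \<in> \<Omega>" if "l \<in> ball 0 (2 * \<rho>)" for l
      proof -
        have "norm (l *s v) < 2 * \<rho> * norm v"
          using that False by (simp add: norm_vector_smult)
        then have "norm (x - z + l *s v) < r + r"
          using x \<rho>(2) by (intro norm_triangle_lt) (simp add: dist_norm norm_minus_commute)
        then show ?thesis
          using r by (force simp: dist_norm norm_minus_commute algebra_simps)
      qed
      have hol: "(\<lambda>l. f j (x + l *s v)) holomorphic_on ball 0 (2 * \<rho>)"
        by (rule holomorphic_several_along[OF f]) (auto intro!: holomorphic_intros inO)
      have sub: "cball 0 \<rho> \<subseteq> ball (0::complex) (2 * \<rho>)" using \<rho>(1) by auto
      have "norm ((deriv ^^ 1) (\<lambda>l. f j (x + l *s v)) 0) \<le> fact 1 * M j / \<rho> ^ 1"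
      proof (rule Cauchy_inequality)
        show "(\<lambda>l. f j (x + l *s v)) holomorphic_on ball 0 \<rho>"
          using hol by (rule holomorphic_on_subset) (use \<rho> in auto)
        show "continuous_on (cball 0 \<rho>) (\<lambda>l. f j (x + l *s v))"
          using hol sub by (meson continuous_on_subset holomorphic_on_imp_continuous_on)
        show "norm (f j (x + l *s v)) \<le> M j" if "norm (0 - l) = \<rho>" for l
          using that \<rho>(1) by (intro bound inO) auto
      qed (use \<rho> in auto)
      moreover have "deriv (\<lambda>l. f j (x + l *s v)) 0 = D j x v"
      proof -
        have "((\<lambda>l::complex. \<chi> k. x $ k + l * v $ k) has_derivative (\<lambda>h. \<chi> k. h * v $ k)) (at 0)"
          by (intro has_derivative_vec) (auto intro!: derivative_eq_intros)
        then have "((\<lambda>l. x + l *s v) has_derivative (\<lambda>h. h *s v)) (at 0)"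
          by (simp add: vector_scalar_mult_def plus_vec_def)
        from has_derivative_compose[OF this, of "f j" "D j x"]
        have "((\<lambda>l. f j (x + l *s v)) has_derivative (\<lambda>h. D j x (h *s v))) (at 0)"
          using D(1)[of x j] inO[of 0] \<rho>(1) by simp
        then have "((\<lambda>l. f j (x + l *s v)) has_field_derivative D j x v) (at 0)"
          using D(2)[of x j] inO[of 0] \<rho>(1) by (simp add: has_field_derivative_def mult_commute_abs)
        then show ?thesis by (rule DERIV_imp_deriv)
      qed
      ultimately have "norm (D j x v) \<le> M j / \<rho>" by simp
      also have "\<dots> = 2 * M j / r * norm v" using False r by (simp add: \<rho>_def)
      finally show ?thesis .
    qed
    have sM: "summable (\<lambda>j. 2 * M j / r)"
      using M by (intro summable_divide summable_mult)
    have sD: "summable (\<lambda>j. norm (D j x v))" if "x \<in> ball z r" for x v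
    proof (rule summable_comparison_test')
      show "summable (\<lambda>j. 2 * M j / r * norm v)" using sM by (rule summable_mult2)
      show "norm (norm (D j x v)) \<le> 2 * M j / r * norm v" for j using Dbound[OF that] by simp
    qed
    \<comment> \<open>The tail of the differentiated series is small in operator norm, uniformly on
      the ball; this is the form that term-by-term differentiation requires.\<close>
    have ev: "\<forall>\<^sub>F n in sequentially. \<forall>x\<in>ball z r. \<forall>h.
        norm ((\<Sum>i<n. D i x h) - (\<Sum>j. D j x h)) \<le> e * norm h" if "e > 0" for e
    proof -
      have "(\<lambda>n. \<Sum>j. 2 * M (j + n) / r) \<longlonglongrightarrow> 0"
        using suminf_exist_split2[OF sM] by simp
      then have "\<forall>\<^sub>F n in sequentially. (\<Sum>j. 2 * M (j + n) / r) < e"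
        using \<open>e > 0\<close> by (rule order_tendstoD)
      then show ?thesis
      proof (rule eventually_mono, intro ballI allI)
        fix n x h assume n: "(\<Sum>j. 2 * M (j + n) / r) < e" and x: "x \<in> ball z r"
        have "norm ((\<Sum>i<n. D i x h) - (\<Sum>j. D j x h)) = norm (\<Sum>j. D (j + n) x h)"
          by (subst suminf_split_initial_segment[OF summable_norm_cancel[OF sD[OF x, of h]], of n]) simp
        also have "\<dots> \<le> (\<Sum>j. norm (D (j + n) x h))"
          using summable_ignore_initial_segment[OF sD[OF x, of h], of n] by (rule summable_norm)
        also have "\<dots> \<le> (\<Sum>j. 2 * M (j + n) / r * norm h)"
          using Dbound[OF x] summable_ignore_initial_segment[OF sD[OF x, of h], of n]
            summable_mult2[OF summable_ignore_initial_segment[OF sM, of n], of "norm h"]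
          by (intro suminf_le) auto
        also have "\<dots> = (\<Sum>j. 2 * M (j + n) / r) * norm h"
          by (rule suminf_mult2[OF summable_ignore_initial_segment[OF sM, of n], symmetric])
        also have "\<dots> \<le> e * norm h" using n by (intro mult_right_mono) auto
        finally show "norm ((\<Sum>i<n. D i x h) - (\<Sum>j. D j x h)) \<le> e * norm h" .
      qed
    qed
    have in\<Omega>: "x \<in> \<Omega>" if "x \<in> ball z r" for x
      using that r by (auto simp: subset_iff)
    have sf: "summable (\<lambda>j. f j z)"
      by (rule summable_comparison_test'[OF M]) (use bound[OF z] in auto)
    have "\<exists>g. \<forall>x\<in>ball z r. (\<lambda>n. f n x) sums g x \<and>
        (g has_derivative (\<lambda>h. \<Sum>j. D j x h)) (at x within ball z r)"
    proof (rule has_derivative_series[OF convex_ball _ ev])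
      show "(f n has_derivative D n x) (at x within ball z r)" if "x \<in> ball z r" for n x
        using D(1)[OF in\<Omega>[OF that]] by (rule has_derivative_at_withinI)
      show "z \<in> ball z r" using r by simp
      show "(\<lambda>n. f n z) sums (\<Sum>j. f j z)" using sf by (rule summable_sums)
    qed
    then obtain g where g: "\<And>x. x \<in> ball z r \<Longrightarrow> (\<lambda>n. f n x) sums g x"
      "\<And>x. x \<in> ball z r \<Longrightarrow> (g has_derivative (\<lambda>h. \<Sum>j. D j x h)) (at x within ball z r)"
      by metis
    have zb: "z \<in> ball z r" using r by simp
    have "(g has_derivative (\<lambda>h. \<Sum>j. D j z h)) (at z)"
      using g(2)[OF zb] zb by (simp add: at_within_open[OF zb])
    then have "((\<lambda>x. \<Sum>j. f j x) has_derivative (\<lambda>h. \<Sum>j. D j z h)) (at z)"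
      by (rule has_derivative_transform_within_open[OF _ open_ball zb])
         (metis g(1) sums_unique)
    moreover have "(\<Sum>j. D j z (c *s v)) = c * (\<Sum>j. D j z v)" for c v
      using suminf_mult[OF summable_norm_cancel[OF sD[OF zb]]] by (simp add: D(2)[OF z])
    ultimately show "\<exists>D. ((\<lambda>x. \<Sum>j. f j x) has_derivative D) (at z) \<and> (\<forall>c v. D (c *s v) = c * D v)"
      by blast
  qed
qed

section \<open>Radial limits and null sets\<close>

text \<open>A nonempty open set is not negligible. This later selects a good slice inside a
  prescribed open set of angles.\<close>

lemma AE_lborel_open_ex:
  fixes U :: "'a::euclidean_space set"
  assumes "AE x in lborel. P x" "open U" "U \<noteq> {}"
  obtains x where "x \<in> U" "P x"
proof -
  obtain N where N: "{x. \<not> P x} \<subseteq> N" "N \<in> sets borel" "emeasure lborel N = 0"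
    using AE_E[OF assms(1)] by auto
  then have "negligible N"
    unfolding negligible_iff_null_sets by (intro null_sets_completionI) auto
  then have "\<not> U \<subseteq> N"
    using open_not_negligible[OF assms(2,3)] negligible_subset by blast
  then show ?thesis using that N by blast
qed

lemma AE_lborel_ex:
  assumes "AE x in (lborel :: 'a::euclidean_space measure). P x" shows "\<exists>x. P x"
  using AE_lborel_open_ex[OF assms open_UNIV] by auto


section \<open>Bounded holomorphic functions on the disc and their radial limits\<close>

text \<open>Cauchy's formula on the circle of radius \<open>R\<close>, with the kernel estimated by
  \<open>1 / (R - norm z)\<close>. The lost factor is harmless: it is \<open>1\<close> at the centre
  after \<open>R \<rightarrow> 1\<close>, and elsewhere it is removed by passing to powers of
  \<open>g\<close>.\<close>

lemma cauchy_circle_bound: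
  assumes hol: "g holomorphic_on ball 0 1" and z: "norm z < R" and R: "R < 1"
  shows "(R - norm z) * norm (g z) \<le> (LINT t:{0..1}|lborel. norm (g (of_real R * cis (2 * pi * t))))"
proof -
  have R0: "R > 0" using z norm_ge_zero[of z] by linarith
  have sub: "cball 0 R \<subseteq> ball (0::complex) 1" using R by auto
  have cont: "continuous_on (cball 0 R) g"
    using hol sub by (meson continuous_on_subset holomorphic_on_imp_continuous_on)
  define e where "e = (\<lambda>t::real. of_real R * cis (2 * pi * t))"
  have ne: "norm (e t) = R" for t using R0 by (simp add: e_def norm_mult)
  have conte: "continuous_on A e" for A unfolding e_def by (intro continuous_intros)
  have e_eq: "of_real R * exp (2 * of_real pi * \<i> * of_real t) = e t" for t
    by (simp add: e_def cis_conv_exp algebra_simps)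
  have cp: "circlepath 0 R t = e t" for t
    using e_eq[of t] by (simp add: circlepath)
  have vd: "vector_derivative (circlepath 0 R) (at t within {0..1}) = 2 * pi * \<i> * e t" if "t \<in> {0..1}" for t
    using that e_eq[of t] by (subst vector_derivative_circlepath01) auto
  have contge: "continuous_on A (\<lambda>t. g (e t))" for A
    by (rule continuous_on_compose2[OF cont conte]) (simp add: ne image_subset_iff)
  have "((\<lambda>u. g u / (u - z)) has_contour_integral (2 * of_real pi * \<i> * g z)) (circlepath 0 R)"
    by (rule Cauchy_integral_circlepath[OF cont]) (use hol R z in \<open>auto intro: holomorphic_on_subset\<close>)
  then have "((\<lambda>t. g (e t) / (e t - z) * (2 * pi * \<i> * e t)) has_integral (2 * of_real pi * \<i> * g z)) {0..1}"
    unfolding has_contour_integral_def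
    by (rule has_integral_eq[rotated])
       (simp add: vd cp)
  from has_integral_mult_right[OF this, of "1 / (2 * pi * \<i>)"]
  have hi: "((\<lambda>t. g (e t) * e t / (e t - z)) has_integral g z) {0..1}"
    by (simp add: field_simps)
  have d: "R - norm z \<le> norm (e t - z)" for t
    using norm_triangle_ineq2[of "e t" z] by (simp add: ne)
  have cn: "continuous_on {0..1} (\<lambda>t. norm (g (e t)))"
    by (intro continuous_intros contge)
  have "norm (g z) \<le> integral {0..1} (\<lambda>t. norm (g (e t)) / (R - norm z))"
  proof -
    have "norm (integral {0..1} (\<lambda>t. g (e t) * e t / (e t - z))) \<le> integral {0..1} (\<lambda>t. norm (g (e t)) / (R - norm z))"
    proof (rule integral_norm_bound_integral)
      show "(\<lambda>t. g (e t) * e t / (e t - z)) integrable_on {0..1}" using hi by blast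
      show "(\<lambda>t. norm (g (e t)) / (R - norm z)) integrable_on {0..1}"
        by (intro integrable_continuous_interval continuous_intros contge) (use z in auto)
      show "norm (g (e t) * e t / (e t - z)) \<le> norm (g (e t)) / (R - norm z)" for t
      proof -
        have "norm (g (e t) * e t / (e t - z)) = norm (g (e t)) * R / norm (e t - z)"
          by (simp add: norm_divide norm_mult ne)
        also have "\<dots> \<le> norm (g (e t)) * 1 / (R - norm z)"
          using z R R0 d by (intro frac_le mult_left_mono) auto
        finally show ?thesis by simp
      qed
    qed
    then show ?thesis using hi by (simp add: integral_unique)
  qed
  also have "\<dots> = integral {0..1} (\<lambda>t. norm (g (e t))) / (R - norm z)" by simp
  finally have "(R - norm z) * norm (g z) \<le> integral {0..1} (\<lambda>t. norm (g (e t)))"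
    using z by (simp add: field_simps)
  also have "\<dots> = (LINT t:{0..1}|lborel. norm (g (e t)))"
  proof (rule set_borel_integral_eq_integral(2)[symmetric])
    show "set_integrable lborel {0..1} (\<lambda>t. norm (g (e t)))"
      by (rule borel_integrable_atLeastAtMost') (rule cn)
  qed
  finally show ?thesis by (simp add: e_def)
qed

text \<open>A fixed sequence of radii increasing to 1. It makes radial limits sequential, for
  measurability and dominated convergence, and later serves as threshold in the choice of
  exponents.\<close>

definition radial :: "nat \<Rightarrow> real" where "radial n = 1 - 1 / (real n + 2)"

lemma radial: "0 < radial n" "radial n < 1" "radial \<longlonglongrightarrow> 1"
proof -
  show "0 < radial n" "radial n < 1" by (auto simp: radial_def field_simps)
  show "radial \<longlonglongrightarrow> 1"
    unfolding radial_def
    using tendsto_diff[OF tendsto_const LIMSEQ_ignore_initial_segment[OF lim_inverse_n', of 2], of 1]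
    by (simp add: add.commute)
qed

lemma radial_at_left: "filterlim radial (at_left 1) sequentially"
  using radial by (auto simp: filterlim_at intro!: always_eventually) (metis less_irrefl)

text \<open>Dominated convergence in the previous bound as the radius tends to 1. Only the modulus
  of \<open>g\<close> is required to have limits; in the application with \<open>z = 0\<close>
  nothing is known about the argument.\<close>

lemma radial_integral_bound:
  assumes hol: "g holomorphic_on ball 0 1" and B: "\<And>z. z \<in> ball 0 1 \<Longrightarrow> norm (g z) \<le> B"
    and lim: "AE t in lborel. ((\<lambda>r. norm (g (of_real r * cis (2 * pi * t)))) \<longlongrightarrow> b t) (at_left 1)"
    and b: "b \<in> borel_measurable lborel" and z: "norm z < 1"
  shows "(1 - norm z) * norm (g z) \<le> (LINT t:{0..1}|lborel. b t)"
proof -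
  let ?e = "\<lambda>n t. of_real (radial n) * cis (2 * pi * t)"
  have in1: "?e n t \<in> ball 0 1" for n t using radial(1,2)[of n] by (simp add: norm_mult)
  have cont: "continuous_on UNIV (\<lambda>t. g (?e n t))" for n
    by (rule continuous_on_compose2[OF holomorphic_on_imp_continuous_on[OF hol]])
       (use in1 in \<open>auto intro!: continuous_intros\<close>)
  have "(\<lambda>n. LINT t:{0..1}|lborel. norm (g (?e n t))) \<longlonglongrightarrow> (LINT t:{0..1}|lborel. b t)"
    unfolding set_lebesgue_integral_def
  proof (rule integral_dominated_convergence[where w = "\<lambda>t. indicator {0..1::real} t * B"])
    show "AE t in lborel. (\<lambda>n. indicat_real {0..1::real} t *\<^sub>R norm (g (?e n t))) \<longlonglongrightarrow> indicat_real {0..1::real} t *\<^sub>R b t"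
      using lim
    proof eventually_elim
      case (elim t)
      then have "(\<lambda>n. norm (g (?e n t))) \<longlonglongrightarrow> b t"
        using radial_at_left by (rule filterlim_compose)
      then show ?case by (intro tendsto_intros)
    qed
    show "integrable lborel (\<lambda>t. indicat_real {0..1::real} t * B)"
      by (intro integrable_mult_left) (simp add: integrable_indicator_iff)
    show "AE t in lborel. norm (indicat_real {0..1::real} t *\<^sub>R norm (g (?e n t))) \<le> indicat_real {0..1::real} t * B" for n
      using B[OF in1] by (intro AE_I2) (auto simp: indicator_def)
    show "(\<lambda>t. indicat_real {0..1::real} t *\<^sub>R norm (g (?e n t))) \<in> borel_measurable lborel" for n
      using borel_measurable_continuous_onI[OF cont[of n]] by measurable
    show "(\<lambda>t. indicat_real {0..1::real} t *\<^sub>R b t) \<in> borel_measurable lborel"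
      using b by measurable
  qed
  moreover have "(\<lambda>n. (radial n - norm z) * norm (g z)) \<longlonglongrightarrow> (1 - norm z) * norm (g z)"
    by (intro tendsto_intros radial)
  moreover have "\<forall>\<^sub>F n in sequentially. (radial n - norm z) * norm (g z) \<le> (LINT t:{0..1}|lborel. norm (g (?e n t)))"
    using order_tendstoD(1)[OF radial(3) z]
    by eventually_elim (rule cauchy_circle_bound[OF hol _ radial(2)])
  ultimately show ?thesis
    by (intro tendsto_le[OF _ _ _]) auto
qed

text \<open>The limit along the sequence of radii is a measurable function on all of the line, and
  it agrees with the radial limit wherever that exists.\<close>

lemma radial_limit_measurable:
  assumes hol: "g holomorphic_on ball 0 1"
    and lim: "AE t in lborel. \<exists>l. ((\<lambda>r. g (of_real r * cis (2 * pi * t))) \<longlongrightarrow> l) (at_left 1) \<and> P t l"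
  obtains a :: "real \<Rightarrow> complex" where "a \<in> borel_measurable lborel"
    and "AE t in lborel. ((\<lambda>r. g (of_real r * cis (2 * pi * t))) \<longlongrightarrow> a t) (at_left 1) \<and> P t (a t)"
proof
  let ?e = "\<lambda>n t. of_real (radial n) * cis (2 * pi * t)"
  let ?a = "\<lambda>t. lim (\<lambda>n. g (?e n t))"
  have in1: "?e n t \<in> ball 0 1" for n t using radial(1,2)[of n] by (simp add: norm_mult)
  have cont: "continuous_on UNIV (\<lambda>t. g (?e n t))" for n
    by (rule continuous_on_compose2[OF holomorphic_on_imp_continuous_on[OF hol]])
       (use in1 in \<open>auto intro!: continuous_intros\<close>)
  then show "?a \<in> borel_measurable lborel"
    by (intro borel_measurable_lim_metric) (auto intro: borel_measurable_continuous_onI)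
  show "AE t in lborel. ((\<lambda>r. g (of_real r * cis (2 * pi * t))) \<longlongrightarrow> ?a t) (at_left 1) \<and> P t (?a t)"
    using lim
  proof eventually_elim
    case (elim t)
    then obtain l where l: "((\<lambda>r. g (of_real r * cis (2 * pi * t))) \<longlongrightarrow> l) (at_left 1)" "P t l" by blast
    then have "(\<lambda>n. g (?e n t)) \<longlonglongrightarrow> l"
      using radial_at_left by (intro filterlim_compose[OF l(1)])
    then have "?a t = l" by (rule limI)
    then show ?case using l by simp
  qed
qed

text \<open>Maximum principle for radial limits without the Poisson kernel: the bound for
  \<open>g ^ n\<close> reads \<open>(1 - norm z) * norm (g z) ^ n \<le> C ^ n\<close>, and
  \<open>n \<rightarrow> \<infinity>\<close> makes the first factor irrelevant.\<close>

lemma radial_limits_bound: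
  assumes hol: "g holomorphic_on ball 0 1" and B: "\<And>z. z \<in> ball 0 1 \<Longrightarrow> norm (g z) \<le> B"
    and lim: "AE t in lborel. \<exists>l. ((\<lambda>r. g (of_real r * cis (2 * pi * t))) \<longlongrightarrow> l) (at_left 1) \<and> (t \<in> {0..1} \<longrightarrow> norm l \<le> C)"
    and z: "norm z < 1"
  shows "norm (g z) \<le> C"
proof -
  obtain a where a: "a \<in> borel_measurable lborel"
    "AE t in lborel. ((\<lambda>r. g (of_real r * cis (2 * pi * t))) \<longlongrightarrow> a t) (at_left 1) \<and> (t \<in> {0..1} \<longrightarrow> norm (a t) \<le> C)"
    by (rule radial_limit_measurable[OF hol lim])
  \<comment> \<open>One limit at a parameter in (0,1) already forces \<open>C\<close> to be
    nonnegative.\<close>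
  have "\<exists>t. norm (a t) \<le> C"
    by (rule AE_lborel_open_ex[OF a(2), of "{0<..<1}"]) auto
  then have C0: "0 \<le> C" using norm_ge_zero order_trans by blast
  have key: "(1 - norm z) * norm (g z) ^ n \<le> C ^ n" for n
  proof -
    have "(1 - norm z) * norm (g z ^ n) \<le> (LINT t:{0..1}|lborel. norm (a t) ^ n)"
    proof (rule radial_integral_bound)
      show "(\<lambda>z. g z ^ n) holomorphic_on ball 0 1" using hol by (intro holomorphic_intros)
      show "norm (g z ^ n) \<le> B ^ n" if "z \<in> ball 0 1" for z
        using B[OF that] by (simp add: norm_power power_mono)
      show "AE t in lborel. ((\<lambda>r. norm (g (of_real r * cis (2 * pi * t)) ^ n)) \<longlongrightarrow> norm (a t) ^ n) (at_left 1)"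
        using a(2) by eventually_elim (auto simp: norm_power intro!: tendsto_intros)
      show "(\<lambda>t. norm (a t) ^ n) \<in> borel_measurable lborel" using a(1) by measurable
    qed (rule z)
    also have "\<dots> \<le> (LINT t:{0..1::real}|lborel. C ^ n)"
      unfolding set_lebesgue_integral_def
    proof (rule integral_mono_AE')
      show "integrable lborel (\<lambda>t. indicat_real {0..1::real} t *\<^sub>R C ^ n)"
        by (intro integrable_scaleR_left) (simp add: integrable_indicator_iff)
      show "AE t in lborel. indicat_real {0..1::real} t *\<^sub>R norm (a t) ^ n \<le> indicat_real {0..1::real} t *\<^sub>R C ^ n"
        using a(2) by eventually_elim (auto simp: indicator_def intro!: power_mono)
      show "AE t in lborel. 0 \<le> indicat_real {0..1::real} t *\<^sub>R C ^ n"
        using C0 by simp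
    qed
    also have "\<dots> = C ^ n" by (simp add: set_lebesgue_integral_def)
    finally show ?thesis by (simp add: norm_power)
  qed
  show ?thesis
  proof (rule ccontr)
    assume "\<not> norm (g z) \<le> C"
    then have less: "C < norm (g z)" by simp
    then have pos: "norm (g z) > 0" using C0 by linarith
    have "(\<lambda>n. (C / norm (g z)) ^ n) \<longlonglongrightarrow> 0"
      using less C0 pos by (intro LIMSEQ_power_zero) simp
    moreover have "1 - norm z \<le> (C / norm (g z)) ^ n" for n
      using key[of n] pos by (simp add: field_simps)
    ultimately have "1 - norm z \<le> 0" by (intro LIMSEQ_le_const[of _ 0]) auto
    then show False using z by simp
  qed
qed

section \<open>Null sets, parallel lines and periodicity\<close>

lemma AE_lborel_translate:
  fixes c :: "'a::euclidean_space"
  assumes "AE x in lborel. P x" shows "AE x in lborel. P (c + x)"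
  using assms AE_distrD[of "(+) c" lborel borel P] unfolding lborel_distr_plus by simp

lemma AE_lborel_commute_lines:
  fixes v :: "'a::euclidean_space"
  assumes [measurable]: "N \<in> sets borel"
  shows "(AE x in lborel. AE t in lborel. x + t *\<^sub>R v \<notin> N) \<longleftrightarrow>
    (AE t in lborel. AE x in lborel. x + (t::real) *\<^sub>R v \<notin> N)"
  by (rule lborel_pair.AE_commute) measurable

text \<open>Translates of a null set are null, so the swapped statement holds for every
  \<open>t\<close>; Fubini swaps back. With the diagonal direction this says that almost every slice
  is good at almost every angle.\<close>

lemma AE_lborel_lines:
  fixes v :: "'a::euclidean_space"
  assumes "AE x in lborel. P x" shows "AE x in lborel. AE t in lborel. P (x + (t::real) *\<^sub>R v)"
proof -
  obtain N where N: "{x. \<not> P x} \<subseteq> N" "N \<in> sets borel" "emeasure lborel N = 0"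
    using AE_E[OF assms] by auto
  then have "AE x in lborel. x \<notin> N" by (intro AE_not_in) auto
  from AE_lborel_translate[OF this]
  have "AE t in lborel. AE x in lborel. x + (t::real) *\<^sub>R v \<notin> N"
    by (simp add: add.commute[of _ "_ *\<^sub>R v"])
  then have "AE x in lborel. AE t in lborel. x + (t::real) *\<^sub>R v \<notin> N"
    using AE_lborel_commute_lines[OF N(2)] by blast
  then show ?thesis
  proof eventually_elim
    case (elim x)
    then show ?case by eventually_elim (use N(1) in auto)
  qed
qed

text \<open>After Fubini a single good \<open>t\<close> suffices, since translating by
  \<open>- t *\<^sub>R v\<close> recovers the statement about \<open>S\<close> itself.\<close>

lemma AE_lborel_of_lines:
  fixes v :: "'a::euclidean_space"
  assumes S: "S \<in> sets borel" and lines: "AE x in lborel. AE t in lborel. x + (t::real) *\<^sub>R v \<notin> S"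
  shows "AE x in lborel. x \<notin> S"
proof -
  have "AE t in lborel. AE x in lborel. x + (t::real) *\<^sub>R v \<notin> S"
    using AE_lborel_commute_lines[OF S] lines by blast
  then obtain t :: real where "AE x in lborel. x + t *\<^sub>R v \<notin> S"
    using AE_lborel_ex by blast
  from AE_lborel_translate[OF this, of "- t *\<^sub>R v"] show ?thesis by simp
qed

text \<open>Subtracting integer parts moves every point into the unit cube, and there are only
  countably many integer translations.\<close>

lemma AE_lborel_periodic:
  fixes P :: "real ^ 'n::finite \<Rightarrow> bool"
  assumes cube: "AE x in lborel. x \<in> cbox 0 (\<chi> i. 1) \<longrightarrow> P x"
    and per: "\<And>x k. P x \<Longrightarrow> P ((\<chi> i. of_int (k i)) + x)"
  shows "AE x in lborel. P x"
proof -
  have "AE x in lborel. (\<chi> i. - of_int (k i)) + x \<in> cbox 0 (\<chi> i. 1) \<longrightarrow> P ((\<chi> i. - of_int (k i)) + x)"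
    for k :: "'n \<Rightarrow> int"
    using AE_lborel_translate[OF cube] .
  then have "AE x in lborel. \<forall>k :: 'n \<Rightarrow> int. (\<chi> i. - of_int (k i)) + x \<in> cbox 0 (\<chi> i. 1) \<longrightarrow>
      P ((\<chi> i. - of_int (k i)) + x)"
    by (simp add: AE_all_countable)
  then show ?thesis
  proof eventually_elim
    case (elim x)
    have "(\<chi> i. - of_int \<lfloor>x $ i\<rfloor>) + x \<in> cbox 0 (\<chi> i. 1)"
      by (auto simp: mem_box_cart) linarith+
    with elim[rule_format, of "\<lambda>i. \<lfloor>x $ i\<rfloor>"] have "P ((\<chi> i. - of_int \<lfloor>x $ i\<rfloor>) + x)" .
    from per[OF this, of "\<lambda>i. \<lfloor>x $ i\<rfloor>"] show ?case
      by (simp add: plus_vec_def)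
  qed
qed

section \<open>The domain and its slices\<close>

lemma prod_one_plus_elem_sym:
  fixes x :: "complex ^ 'n::finite"
  shows "(\<Prod>i\<in>UNIV. 1 + y * x $ i) = (\<Sum>j\<le>CARD('n). elem_sym j x * y ^ j)"
proof -
  have "(\<Prod>i\<in>UNIV. 1 + y * x $ i) = (\<Prod>i\<in>UNIV. y * x $ i + 1)"
    by (simp add: add.commute)
  also have "\<dots> = (\<Sum>S\<in>UNIV. (\<Prod>i\<in>S. y * x $ i))"
    by (subst prod_add) auto
  also have "\<dots> = (\<Sum>j\<le>CARD('n). \<Sum>S | S \<in> UNIV \<and> card S = j. (\<Prod>i\<in>S. y * x $ i))"
    by (rule sum.group[symmetric]) (auto intro: card_mono)
  also have "\<dots> = (\<Sum>j\<le>CARD('n). elem_sym j x * y ^ j)"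
    by (intro sum.cong refl) (auto simp: elem_sym_def sum_distrib_right prod.distrib intro!: sum.cong)
  finally show ?thesis .
qed

lemma elem_sym_0: "elem_sym 0 (x :: complex ^ 'n::finite) = 1"
proof -
  have "{S :: 'n::finite set. card S = 0} = {{}}" by auto
  then show ?thesis by (simp add: elem_sym_def)
qed

lemma elem_sym_1: "elem_sym (Suc 0) (x :: complex ^ 'n::finite) = (\<Sum>i\<in>UNIV. x $ i)"
proof -
  have "{S :: 'n::finite set. card S = Suc 0} = (\<lambda>i. {i}) ` UNIV" by (auto simp: card_Suc_eq)
  then show ?thesis by (simp add: elem_sym_def sum.reindex inj_on_def)
qed

lemma elem_sym_card: "elem_sym (CARD('n)) (x :: complex ^ 'n::finite) = (\<Prod>i\<in>UNIV. x $ i)"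
proof -
  have "{S :: 'n::finite set. card S = CARD('n)} = {UNIV}" 
    using card_subset_eq[OF finite subset_UNIV] by blast
  then show ?thesis by (simp add: elem_sym_def)
qed

text \<open>A set of \<open>CARD('n) - 1\<close> indices omits exactly one index, and omitting a
  unimodular factor from the full product is multiplying by its conjugate.\<close>

lemma elem_sym_pred_card:
  fixes x :: "complex ^ 'n::finite"
  assumes unit: "\<And>i. norm (x $ i) = 1"
  shows "elem_sym (CARD('n) - 1) x = (\<Prod>i\<in>UNIV. x $ i) * cnj (\<Sum>i\<in>UNIV. x $ i)"
proof -
  have card_Compl: "card (- S) = CARD('n) - card S" for S :: "'n set"
    by (simp add: Compl_eq_Diff_UNIV card_Diff_subset)
  have "S \<in> (\<lambda>i. - {i}) ` UNIV" if "card S = CARD('n) - 1" for S :: "'n set"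
  proof -
    have "card (- S) = 1"
      using that card_Compl[of S] by (simp add: Suc_leI)
    then obtain i where "- S = {i}" by (auto simp: card_1_singleton_iff)
    then have "S = - {i}" by auto
    then show ?thesis by blast
  qed
  then have "{S :: 'n::finite set. card S = CARD('n) - 1} = (\<lambda>i. - {i}) ` UNIV"
    by (auto simp: card_Compl)
  moreover have "inj (\<lambda>i::'n. - {i})" by (auto simp: inj_on_def)
  ultimately have "elem_sym (CARD('n) - 1) x = (\<Sum>i\<in>UNIV. \<Prod>j\<in>-{i}. x $ j)"
    by (simp add: elem_sym_def sum.reindex)
  moreover have "(\<Prod>j\<in>-{i}. x $ j) = (\<Prod>j\<in>UNIV. x $ j) * cnj (x $ i)" for i
  proof -
    have "(\<Prod>j\<in>UNIV. x $ j) = x $ i * (\<Prod>j\<in>-{i}. x $ j)"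
      by (subst prod.remove[of _ i]) (auto simp: Compl_eq_Diff_UNIV)
    moreover have "x $ i * cnj (x $ i) = 1"
      using unit[of i] by (simp add: complex_norm_square[symmetric])
    ultimately show ?thesis by (simp add: mult.commute mult.left_commute)
  qed
  ultimately show ?thesis by (simp add: sum_distrib_left)
qed

lemma norm_elem_sym_le:
  fixes x :: "complex ^ 'n::finite"
  assumes "\<And>i. norm (x $ i) \<le> 1" shows "norm (elem_sym j x) \<le> 2 ^ CARD('n)"
proof -
  have "norm (elem_sym j x) \<le> (\<Sum>S | card (S :: 'n set) = j. 1)"
    unfolding elem_sym_def
    by (intro sum_norm_le) (use assms in \<open>auto simp: prod_norm[symmetric] intro!: prod_le_1\<close>)
  also have "\<dots> \<le> real (card (Pow (UNIV :: 'n set)))"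
    by (simp del: Pow_UNIV) (intro card_mono, auto)
  finally show ?thesis by (simp add: card_Pow del: Pow_UNIV)
qed

lemma elem_sym_smult: "elem_sym j (c *s x) = c ^ j * elem_sym j x"
  by (auto simp: elem_sym_def sum_distrib_left prod.distrib intro!: sum.cong)

lemma elem_sym_power_smult:
  "elem_sym j (\<chi> i. c ^ m * z $ i ^ m) = c ^ (m * j) * elem_sym j (\<chi> i. z $ i ^ m)"
  using elem_sym_smult[of j "c ^ m" "\<chi> i. z $ i ^ m"]
  by (simp add: vector_scalar_mult_def power_mult)

locale theta_map =
  fixes ix :: "'n::finite \<Rightarrow> nat" and m t :: nat
  assumes card: "CARD('n) > 1" and bij: "bij_betw ix UNIV {1..CARD('n)}"
    and m: "m > 0" and t: "t > 0" and dvd: "t dvd m"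
begin

abbreviation "\<Omega> \<equiv> theta_domain ix m t"
abbreviation "\<theta> \<equiv> theta ix m t"

definition idx :: "nat \<Rightarrow> 'n" where "idx = inv_into UNIV ix"

lemma ix_idx: "1 \<le> j \<Longrightarrow> j \<le> CARD('n) \<Longrightarrow> ix (idx j) = j"
  using bij unfolding idx_def bij_betw_def by (intro f_inv_into_f) auto

lemma ix_inj: "ix k = ix l \<longleftrightarrow> k = l"
  using bij unfolding bij_betw_def by (auto dest: injD)

lemma ix_range: "1 \<le> ix k" "ix k \<le> CARD('n)"
  using bij unfolding bij_betw_def by auto

lemma ix_pos: "(ix k = 0) = False"
  using ix_range(1)[of k] by auto

lemma mt: "m div t > 0" "m div t * t = m"
  using m t dvd by (auto simp: dvd_div_mult_self div_greater_zero_iff dvd_imp_le)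

section \<open>The domain described by the roots of a polynomial\<close>

text \<open>The last component of \<theta> is an (m/t)-th power of the product of the coordinates;
  raising it to the power \<open>t\<close> recovers the top elementary symmetric polynomial of the
  m-th powers.\<close>

definition sym_coeff :: "complex ^ 'n \<Rightarrow> 'n \<Rightarrow> complex" where
  "sym_coeff q k = (if ix k = CARD('n) then q $ k ^ t else q $ k)"

text \<open>For \<open>q = \<theta> z\<close> this is the product of the factors
  \<open>1 + y * z $ i ^ m\<close>.\<close>

definition sym_poly :: "complex ^ 'n \<Rightarrow> complex \<Rightarrow> complex" where
  "sym_poly q y = 1 + (\<Sum>k\<in>UNIV. sym_coeff q k * y ^ ix k)"

lemma sym_coeff_theta: "sym_coeff (\<theta> z) k = elem_sym (ix k) (\<chi> i. z $ i ^ m)"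
  by (simp add: sym_coeff_def theta_def elem_sym_card power_mult[symmetric] mt prod_power_distrib)

lemma prod_one_plus_eq:
  fixes x :: "complex ^ 'n"
  shows
  "(\<Prod>i\<in>UNIV. 1 + y * x $ i) = 1 + (\<Sum>k\<in>UNIV. elem_sym (ix k) x * y ^ ix k)"
proof -
  have "{..CARD('n)} = insert 0 {1..CARD('n)}" by auto
  then have "(\<Sum>j\<le>CARD('n). elem_sym j x * y ^ j) = 1 + (\<Sum>j\<in>{1..CARD('n)}. elem_sym j x * y ^ j)"
    by (simp add: elem_sym_0)
  also have "(\<Sum>j\<in>{1..CARD('n)}. elem_sym j x * y ^ j) = (\<Sum>k\<in>UNIV. elem_sym (ix k) x * y ^ ix k)"
    by (rule sum.reindex_bij_betw[OF bij, symmetric])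
  finally show ?thesis by (simp add: prod_one_plus_elem_sym)
qed

text \<open>Vieta: the prescribed values are, up to order, the coefficients of a monic polynomial,
  which splits over the complex numbers.\<close>

lemma exists_roots:
  obtains x :: "complex ^ 'n" where "\<And>k. elem_sym (ix k) x = c k"
proof -
  let ?d = "CARD('n)"
  define S where "S = (\<Sum>k\<in>UNIV. monom (c k) (?d - ix k))"
  define P where "P = monom 1 ?d + S"
  have "degree S \<le> ?d - 1"
    unfolding S_def
    by (intro degree_sum_le) (auto intro!: order_trans[OF degree_monom_le] diff_le_mono2 ix_range(1)[unfolded One_nat_def])
  then have S: "degree S < ?d"
    using card by linarith
  then have deg: "degree P = ?d"
    unfolding P_def by (subst degree_add_eq_left) (simp_all add: degree_monom_eq)
  have "coeff P ?d = 1"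
    using S by (simp add: P_def coeff_eq_0)
  then have lead: "lead_coeff P = 1" by (simp only: deg)
  have "P \<noteq> 0" using lead by auto
  obtain A where A: "size A = ?d" "P = smult (lead_coeff P) (\<Prod>x\<in>#A. [:-x, 1:])"
    using alg_closed_imp_factorization[OF \<open>P \<noteq> 0\<close>] unfolding deg by blast
  obtain as where as: "mset as = A" using ex_mset by blast
  have len: "length as = ?d" using A(1) as by auto
  \<comment> \<open>Negated roots give factors \<open>y + x $ k\<close>; list positions start at 0
    while \<open>ix\<close> starts at 1.\<close>
  define x :: "complex ^ 'n" where "x = (\<chi> k. - as ! (ix k - 1))"
  have P: "poly P y = (\<Prod>k\<in>UNIV. y + x $ k)" for y
  proof -
    have "poly P y = poly (\<Prod>a\<leftarrow>as. [:-a, 1:]) y"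
      by (subst A(2), subst lead) (simp add: as[symmetric] prod_mset_prod_list[symmetric])
    also have "\<dots> = (\<Prod>a\<leftarrow>as. y - a)"
      by (induction as) (auto simp: algebra_simps)
    also have "\<dots> = (\<Prod>i<?d. y - as ! i)"
      by (subst prod.list_conv_set_nth) (simp add: len atLeast0LessThan)
    also have "\<dots> = (\<Prod>j\<in>{1..?d}. y - as ! (j - 1))"
      by (rule prod.reindex_bij_witness[of _ "\<lambda>j. j - 1" Suc]) auto
    also have "\<dots> = (\<Prod>k\<in>UNIV. y - as ! (ix k - 1))"
      by (rule prod.reindex_bij_betw[OF bij, symmetric])
    finally show ?thesis by (simp add: x_def)
  qed
  define p1 where "p1 = (\<Sum>k\<in>UNIV. monom (c k) (ix k))"
  define p2 where "p2 = (\<Sum>k\<in>UNIV. monom (elem_sym (ix k) x) (ix k))"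
  have "poly p1 y = poly p2 y" for y
  proof (cases "y = 0")
    case True
    then show ?thesis by (simp add: p1_def p2_def poly_sum poly_monom power_0_left ix_pos)
  next
    case False
    have pow: "y ^ ?d * (1 / y) ^ (?d - j) = y ^ j" if "j \<le> ?d" for j
      using False that by (simp add: power_diff field_simps)
    \<comment> \<open>Reversing the coefficients of \<open>P\<close> turns its factorisation into
      the generating product \<open>\<Prod>k. 1 + y * x $ k\<close>.\<close>
    have "y ^ ?d * poly P (1 / y) = y ^ ?d * (1 / y) ^ (?d - 0) + (\<Sum>k\<in>UNIV. c k * (y ^ ?d * (1 / y) ^ (?d - ix k)))"
      by (simp add: P_def S_def poly_sum poly_monom distrib_left sum_distrib_left mult.left_commute)
    also have "\<dots> = 1 + (\<Sum>k\<in>UNIV. c k * y ^ ix k)"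
      by (subst pow, simp, simp only: pow[OF ix_range(2)] power_0)
    also have "\<dots> = 1 + poly p1 y"
      by (simp add: p1_def poly_sum poly_monom)
    finally have "1 + poly p1 y = y ^ ?d * poly P (1 / y)" ..
    also have "\<dots> = (\<Prod>k\<in>UNIV. y * (1 / y + x $ k))"
      by (simp add: P prod.distrib)
    also have "\<dots> = (\<Prod>k\<in>UNIV. 1 + y * x $ k)"
      using False by (intro prod.cong) (auto simp: field_simps)
    also have "\<dots> = 1 + poly p2 y"
      by (simp add: prod_one_plus_eq p2_def poly_sum poly_monom)
    finally show ?thesis by simp
  qed
  then have "p1 = p2" using poly_eq_poly_eq_iff by blast
  moreover have "coeff (\<Sum>l\<in>UNIV. monom (e l) (ix l)) (ix k) = e k" for e :: "'n \<Rightarrow> complex" and k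
    by (simp add: coeff_sum coeff_monom ix_inj)
  ultimately have "elem_sym (ix k) x = c k" for k
    unfolding p1_def p2_def by metis
  then show ?thesis using that by blast
qed

text \<open>A factor \<open>1 + y * x $ i\<close> has no zero in the closed unit disc exactly when
  \<open>norm (x $ i) < 1\<close>. For surjectivity one takes the numbers \<open>x $ i\<close> from
  the polynomial and extracts m-th roots.\<close>

lemma theta_domain_eq: "\<Omega> = {q. \<forall>y\<in>cball 0 1. sym_poly q y \<noteq> 0}"
proof safe
  fix q y assume "q \<in> \<Omega>" and y: "y \<in> cball 0 1" and 0: "sym_poly q y = 0"
  then obtain z where z: "z \<in> polydisc" "q = \<theta> z" by (auto simp: theta_domain_def)
  have "sym_poly q y = (\<Prod>i\<in>UNIV. 1 + y * (\<chi> i. z $ i ^ m) $ i)"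
    unfolding prod_one_plus_eq by (simp add: sym_poly_def z sym_coeff_theta)
  then obtain i where i: "1 + y * z $ i ^ m = 0" using 0 by auto
  then have "y * z $ i ^ m = - 1" by (simp add: add_eq_0_iff)
  then have "norm y * norm (z $ i) ^ m = 1" by (metis norm_minus_cancel norm_mult norm_one norm_power)
  moreover have "norm (z $ i) ^ m < 1"
    using z m by (auto simp: polydisc_def power_less_one_iff)
  ultimately show False
    using y mult_le_one[of "norm y" "norm (z $ i) ^ m"]
    by (metis dual_order.strict_iff_not mem_cball_0 mult_left_le_one_le norm_ge_zero zero_le_power)
next
  fix q assume q: "\<forall>y\<in>cball 0 1. sym_poly q y \<noteq> 0"
  obtain x :: "complex ^ 'n" where x: "\<And>k. elem_sym (ix k) x = sym_coeff q k"
    by (rule exists_roots[of "sym_coeff q"]) blast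
  have Q: "sym_poly q y = (\<Prod>i\<in>UNIV. 1 + y * x $ i)" for y
    by (simp add: sym_poly_def prod_one_plus_eq x)
  have small: "norm (x $ i) < 1" for i
  proof (rule ccontr)
    assume "\<not> norm (x $ i) < 1"
    then have ge: "norm (x $ i) \<ge> 1" by simp
    then have nz: "x $ i \<noteq> 0" by auto
    then have "sym_poly q (- 1 / x $ i) = 0"
      unfolding Q by (auto intro!: prod_zero exI[of _ i])
    moreover have "- 1 / x $ i \<in> cball 0 1"
      using ge by (simp add: norm_divide divide_le_eq)
    ultimately show False using q by blast
  qed
  have "\<forall>i. \<exists>w. w ^ m = x $ i" using nth_root_exists[OF m] by blast
  then obtain w where w: "\<And>i. w i ^ m = x $ i" by metis
  define kd where "kd = idx CARD('n)"
  have kd: "ix kd = CARD('n)" unfolding kd_def using card by (intro ix_idx) auto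
  \<comment> \<open>The last component produced by arbitrary m-th roots; it has the correct t-th
    power, so it is right up to a t-th root of unity.\<close>
  define W where "W = (\<Prod>i\<in>UNIV. w i) ^ (m div t)"
  have "W ^ t = (\<Prod>i\<in>UNIV. x $ i)"
    by (simp add: W_def power_mult[symmetric] mt w prod_power_distrib)
  also have "\<dots> = q $ kd ^ t"
    using x[of kd] kd by (simp add: elem_sym_card sym_coeff_def)
  finally have Wt: "W ^ t = q $ kd ^ t" .
  \<comment> \<open>Every t-th root of unity is \<open>\<alpha> ^ (m div t)\<close> for some
    \<open>\<alpha>\<close> with \<open>\<alpha> ^ m = 1\<close>.\<close>
  obtain \<alpha> where \<alpha>: "\<alpha> ^ m = 1" "\<alpha> ^ (m div t) * W = q $ kd"
  proof (cases "W = 0")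
    case True
    then have "q $ kd = 0" using Wt t by (simp add: power_0_left)
    then show ?thesis using that[of 1] True by simp
  next
    case False
    obtain \<alpha> where a: "\<alpha> ^ (m div t) = q $ kd / W"
      using nth_root_exists[OF mt(1)] by blast
    have "\<alpha> ^ m = (\<alpha> ^ (m div t)) ^ t" by (simp add: power_mult[symmetric] mt)
    also have "\<dots> = 1" using False Wt[symmetric] by (simp add: a power_divide)
    finally show ?thesis using that a False by simp
  qed
  \<comment> \<open>Altering one coordinate by \<alpha> keeps all m-th powers and multiplies the
    full product by \<alpha>.\<close>
  define z :: "complex ^ 'n" where "z = (\<chi> i. if i = kd then \<alpha> * w i else w i)"
  have zm: "z $ i ^ m = x $ i" for i
    using w \<alpha>(1) by (simp add: z_def power_mult_distrib)
  have "norm (z $ i) ^ m < 1" for i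
    using small[of i] by (metis zm norm_power)
  then have "z \<in> polydisc"
    using m by (auto simp: polydisc_def power_less_one_iff)
  moreover have "\<theta> z = q"
  proof -
    have "(\<Prod>i\<in>UNIV. z $ i) = \<alpha> * (\<Prod>i\<in>UNIV. w i)"
    proof -
      have "(\<Prod>i\<in>UNIV. z $ i) = z $ kd * (\<Prod>i\<in>UNIV - {kd}. z $ i)"
        by (rule prod.remove) auto
      also have "(\<Prod>i\<in>UNIV - {kd}. z $ i) = (\<Prod>i\<in>UNIV - {kd}. w i)"
        by (rule prod.cong) (auto simp: z_def)
      also have "z $ kd * \<dots> = \<alpha> * (w kd * (\<Prod>i\<in>UNIV - {kd}. w i))"
        by (simp add: z_def)
      also have "w kd * (\<Prod>i\<in>UNIV - {kd}. w i) = (\<Prod>i\<in>UNIV. w i)"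
        by (rule prod.remove[symmetric]) auto
      finally show ?thesis .
    qed
    then have "(\<Prod>i\<in>UNIV. z $ i) ^ (m div t) = q $ kd"
      using \<alpha>(2) by (simp add: power_mult_distrib W_def)
    moreover have "ix k = CARD('n) \<longleftrightarrow> k = kd" for k
      using kd ix_inj by metis
    moreover have "elem_sym (ix k) x = q $ k" if "k \<noteq> kd" for k
      using x[of k] that calculation(2) by (simp add: sym_coeff_def)
    ultimately show ?thesis
      by (simp add: theta_def vec_eq_iff zm)
  qed
  ultimately show "q \<in> \<Omega>" by (auto simp: theta_domain_def)
qed

text \<open>The condition ranges over a compact disc of values \<open>y\<close>, so by the tube
  lemma it persists in a neighbourhood of \<open>q\<close>.\<close>

lemma open_theta_domain: "open \<Omega>"
proof (subst open_subopen, intro ballI)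
  fix q assume q: "q \<in> \<Omega>"
  have sub: "{q} \<times> cball 0 1 \<subseteq> {p. sym_poly (fst p) (snd p) \<noteq> 0}"
    using q unfolding theta_domain_eq by auto
  have "continuous_on UNIV (\<lambda>p. sym_coeff (fst p) k :: complex)" for k
    by (cases "ix k = CARD('n)") (auto simp: sym_coeff_def intro!: continuous_intros)
  then have "continuous_on UNIV (\<lambda>p. sym_poly (fst p) (snd p))"
    unfolding sym_poly_def by (intro continuous_intros) auto
  then have "open {p. sym_poly (fst p) (snd p) \<noteq> 0}"
    by (intro open_Collect_neq continuous_intros)
  from Elementary_Topology.tube_lemma[OF compact_cball this sub]
  obtain X where "q \<in> X" "open X" "X \<times> cball 0 1 \<subseteq> {p. sym_poly (fst p) (snd p) \<noteq> 0}"
    by blast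
  then show "\<exists>T. open T \<and> q \<in> T \<and> T \<subseteq> \<Omega>"
    unfolding theta_domain_eq by (intro exI[of _ X]) auto
qed

section \<open>Scaling, and the two functions s and v\<close>

text \<open>The degree of homogeneity of the component \<open>k\<close> of \<theta>; dilation on the
  domain corresponds to scaling upstairs.\<close>

definition weight :: "'n \<Rightarrow> nat" where
  "weight k = (if ix k = CARD('n) then CARD('n) * (m div t) else ix k * m)"

lemma theta_smult: "\<theta> (c *s z) = (\<chi> k. c ^ weight k * \<theta> z $ k)"
  by (auto simp: theta_def weight_def vec_eq_iff elem_sym_power_smult prod.distrib power_mult_distrib
      power_mult[symmetric] mult.commute)

lemma theta_dilate_theta: "theta_dilate ix m t r (\<theta> z) = \<theta> (of_real r *s z)"
  by (auto simp: theta_dilate_def theta_smult weight_def vec_eq_iff)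

definition s_fun :: "complex ^ 'n \<Rightarrow> complex" where "s_fun q = q $ idx CARD('n) ^ t"

text \<open>An elementary symmetric polynomial of points in the closed disc is a sum of at most
  \<open>2 ^ CARD('n)\<close> numbers of modulus at most 1, hence the divisor. For
  \<open>CARD('n) = 2\<close> both factors are the same coordinate.\<close>

definition v_fun :: "complex ^ 'n \<Rightarrow> complex" where
  "v_fun q = q $ idx 1 * q $ idx (CARD('n) - 1) / 4 ^ CARD('n)"

lemma s_fun_theta: "s_fun (\<theta> z) = (\<Prod>i\<in>UNIV. z $ i) ^ m"
  using ix_idx[of "CARD('n)"] card
  by (simp add: s_fun_def theta_def power_mult[symmetric] mt)

lemma v_fun_theta: "v_fun (\<theta> z) = elem_sym 1 (\<chi> i. z $ i ^ m) *
    elem_sym (CARD('n) - 1) (\<chi> i. z $ i ^ m) / 4 ^ CARD('n)"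
  using ix_idx[of "CARD('n) - 1"] ix_idx[of 1] card
  by (simp add: v_fun_def theta_def)

lemma s_fun_smult: "s_fun (\<theta> (c *s z)) = c ^ (CARD('n) * m) * s_fun (\<theta> z)"
  by (simp add: s_fun_theta prod.distrib power_mult_distrib power_mult[symmetric])

lemma v_fun_smult: "v_fun (\<theta> (c *s z)) = c ^ (CARD('n) * m) * v_fun (\<theta> z)"
proof -
  have "m * 1 + m * (CARD('n) - 1) = CARD('n) * m"
    using card by (metis add.commute add_mult_distrib2 le_add_diff_inverse2 less_imp_le mult.commute)
  then have "c ^ (m * 1) * c ^ (m * (CARD('n) - 1)) = c ^ (CARD('n) * m)"
    by (simp only: power_add[symmetric])
  then show ?thesis
    unfolding v_fun_theta
    by (simp add: power_mult_distrib elem_sym_power_smult mult_ac del: One_nat_def)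
qed

lemma s_fun_less_1: "q \<in> \<Omega> \<Longrightarrow> norm (s_fun q) < 1"
proof -
  assume "q \<in> \<Omega>"
  then obtain z where z: "z \<in> polydisc" "q = \<theta> z" by (auto simp: theta_domain_def)
  have "(\<Prod>i\<in>UNIV. norm (z $ i)) < (\<Prod>i\<in>(UNIV::'n set). 1)"
    using z by (intro prod_mono_strict) (auto simp: polydisc_def less_imp_le)
  then show ?thesis
    using m by (simp add: z s_fun_theta norm_power prod_norm[symmetric] power_less_one_iff prod_nonneg)
qed

lemma v_fun_le_1: "q \<in> \<Omega> \<Longrightarrow> norm (v_fun q) \<le> 1"
proof -
  assume "q \<in> \<Omega>"
  then obtain z where z: "z \<in> polydisc" "q = \<theta> z" by (auto simp: theta_domain_def)
  have "norm (elem_sym j (\<chi> i. z $ i ^ m)) \<le> 2 ^ CARD('n)" for j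
    using z by (intro norm_elem_sym_le) (auto simp: polydisc_def norm_power power_le_one less_imp_le)
  then have "norm (elem_sym 1 (\<chi> i. z $ i ^ m)) * norm (elem_sym (CARD('n) - 1) (\<chi> i. z $ i ^ m))
      \<le> 2 ^ CARD('n) * 2 ^ CARD('n)"
    by (intro mult_mono) auto
  also have "\<dots> = 4 ^ CARD('n)" by (simp add: power_mult_distrib[symmetric])
  finally show ?thesis by (simp add: z v_fun_theta norm_mult norm_divide norm_power)
qed

section \<open>Angle coordinates on the torus\<close>

definition tor :: "real ^ 'n \<Rightarrow> complex ^ 'n" where "tor x = (\<chi> i. cis (2 * pi * x $ i))"

definition Y :: "real ^ 'n \<Rightarrow> real" where
  "Y x = (norm (\<Sum>i\<in>UNIV. cis (2 * pi * m * x $ i)))\<^sup>2 / 4 ^ CARD('n)"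

lemma norm_tor: "norm (tor x $ i) = 1" by (simp add: tor_def)

lemma tor_power: "tor x $ i ^ m = cis (2 * pi * m * x $ i)"
  unfolding tor_def vec_lambda_beta Complex.DeMoivre by (simp add: mult_ac)

lemma norm_s_fun_tor: "norm (s_fun (\<theta> (tor x))) = 1"
  by (simp add: s_fun_theta norm_power prod_norm[symmetric] norm_tor)

text \<open>On the torus \<open>E_(d-1) = E_d * cnj E_1\<close>, so the product with
  \<open>E_1\<close> is \<open>E_d\<close> times a squared modulus.\<close>

lemma v_fun_tor: "v_fun (\<theta> (tor x)) = s_fun (\<theta> (tor x)) * Y x"
proof -
  let ?S = "\<Sum>i\<in>UNIV. cis (2 * pi * m * x $ i)"
  have "elem_sym (CARD('n) - 1) (\<chi> i. tor x $ i ^ m) = s_fun (\<theta> (tor x)) * cnj ?S"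
    by (subst elem_sym_pred_card) (simp_all add: norm_power norm_tor s_fun_theta prod_power_distrib tor_power)
  moreover have "?S * cnj ?S = (norm ?S)\<^sup>2"
    by (rule complex_norm_square[symmetric])
  ultimately show ?thesis
    by (simp add: v_fun_theta elem_sym_1 tor_power Y_def mult_ac)
qed

lemma Y_range: "0 \<le> Y x" "Y x \<le> 1"
proof -
  show "0 \<le> Y x" by (simp add: Y_def)
  have "norm (\<Sum>i\<in>UNIV. cis (2 * pi * m * x $ i)) \<le> (\<Sum>i\<in>(UNIV::'n set). 1)"
    by (intro sum_norm_le) simp
  also have "\<dots> \<le> 2 ^ CARD('n)" using of_nat_less_two_power[of "CARD('n)", where 'a=real] by simp
  finally have "(norm (\<Sum>i\<in>UNIV. cis (2 * pi * m * x $ i)))\<^sup>2 \<le> (2 ^ CARD('n))\<^sup>2"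
    by (intro power_mono) auto
  also have "(2 ^ CARD('n))\<^sup>2 = (4::real) ^ CARD('n)"
    by (simp add: power2_eq_square power_mult_distrib[symmetric])
  finally show "Y x \<le> 1" by (simp add: Y_def)
qed

text \<open>A shift along the diagonal is a rotation within the slice, so Fubini along diagonal
  lines is Fubini over slices.\<close>

lemma tor_shift: "tor (x + r *\<^sub>R (\<chi> i. 1)) = cis (2 * pi * r) *s tor x"
  by (simp add: tor_def vec_eq_iff cis_mult algebra_simps)

lemma continuous_Y: "continuous_on S Y"
  unfolding Y_def by (intro continuous_intros) auto

lemma continuous_tor: "continuous_on S tor"
  unfolding tor_def by (intro continuous_intros)

lemma tor_periodic: "tor ((\<chi> i. of_int (k i)) + x) = tor x"
  by (simp add: tor_def vec_eq_iff distrib_left cis_mult[symmetric] cis_multiple_2pi)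

lemma tor_in_polydisc: "norm c < 1 \<Longrightarrow> c *s tor x \<in> polydisc"
  by (simp add: polydisc_def norm_mult norm_tor)

lemma theta_in_domain: "norm c < 1 \<Longrightarrow> \<theta> (c *s tor x) \<in> \<Omega>"
  using tor_in_polydisc by (auto simp: theta_domain_def)

end

section \<open>Products with the conjugate of a function in the closed algebra\<close>

lemma at_left_radiiI:
  assumes "\<And>r. 0 < r \<Longrightarrow> r < 1 \<Longrightarrow> P (r::real)" shows "\<forall>\<^sub>F r in at_left 1. P r"
  unfolding eventually_at_left[OF zero_less_one] using assms by (intro exI[of _ 0]) auto

text \<open>Interchange of limits: the limits \<open>a n\<close> inherit the uniform estimates,
  hence form a Cauchy sequence, and its limit is the limit of \<open>h\<close>.\<close>

lemma tendsto_of_uniform_approx: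
  fixes h :: "'a \<Rightarrow> complex"
  assumes F: "F \<noteq> bot"
    and approx: "\<And>n. \<forall>\<^sub>F r in F. norm (h r - g n r) \<le> 1 / (real n + 1)"
    and g: "\<And>n. (g n \<longlongrightarrow> a n) F"
  shows "\<exists>l. (h \<longlongrightarrow> l) F"
proof -
  have diff: "norm (a n - a k) \<le> 1 / (real n + 1) + 1 / (real k + 1)" for n k
  proof (rule tendsto_upperbound[OF _ _ F])
    show "((\<lambda>r. norm (g n r - g k r)) \<longlongrightarrow> norm (a n - a k)) F"
      by (intro tendsto_intros g)
    show "\<forall>\<^sub>F r in F. norm (g n r - g k r) \<le> 1 / (real n + 1) + 1 / (real k + 1)"
      using approx[of n] approx[of k]
    proof eventually_elim
      case (elim r)
      have "norm (g n r - g k r) = norm ((h r - g k r) - (h r - g n r))" by simp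
      also have "\<dots> \<le> norm (h r - g k r) + norm (h r - g n r)" by (rule norm_triangle_ineq4)
      finally show ?case using elim by simp
    qed
  qed
  have lim0: "(\<lambda>n. 1 / (real n + 1)) \<longlonglongrightarrow> 0"
    using LIMSEQ_Suc[OF lim_inverse_n'] by (simp add: add.commute)
  have "Cauchy a"
  proof (rule metric_CauchyI)
    fix e :: real assume "e > 0"
    then have "\<forall>\<^sub>F n in sequentially. 1 / (real n + 1) < e / 2"
      by (intro order_tendstoD(2)[OF lim0]) simp
    then obtain N where N: "\<And>n. n \<ge> N \<Longrightarrow> 1 / (real n + 1) < e / 2"
      unfolding eventually_sequentially by blast
    have "dist (a n) (a k) < e" if "n \<ge> N" "k \<ge> N" for n k
      using diff[of n k] N[OF that(1)] N[OF that(2)] by (simp add: dist_norm)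
    then show "\<exists>N. \<forall>n\<ge>N. \<forall>k\<ge>N. dist (a n) (a k) < e" by blast
  qed
  then obtain l where l: "a \<longlonglongrightarrow> l" using Cauchy_convergent convergent_def by blast
  have "(h \<longlongrightarrow> l) F"
  proof (rule tendstoI)
    fix e :: real assume "e > 0"
    then have "\<forall>\<^sub>F n in sequentially. 1 / (real n + 1) < e / 3 \<and> dist (a n) l < e / 3"
      by (intro eventually_conj order_tendstoD(2)[OF lim0] tendstoD[OF l]) auto
    then obtain n where n: "1 / (real n + 1) < e / 3" "dist (a n) l < e / 3"
      using eventually_happens'[OF sequentially_bot] by blast
    have "\<forall>\<^sub>F r in F. dist (g n r) (a n) < e / 3"
      using \<open>e > 0\<close> by (intro tendstoD[OF g]) auto
    then show "\<forall>\<^sub>F r in F. dist (h r) l < e"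
      using approx[of n]
    proof eventually_elim
      case (elim r)
      then show ?case
        using dist_triangle[of "h r" l "g n r"] dist_triangle[of "g n r" l "a n"] n
        by (simp add: dist_norm)
    qed
  qed
  then show ?thesis ..
qed

section \<open>The algebra of bounded holomorphic functions\<close>

text \<open>Since members vanish off \<open>\<Omega>\<close> the bound is global; it is taken
  positive so that one may divide by it.\<close>

lemma Hinf_bounded:
  assumes "f \<in> Hinf \<Omega>" obtains M where "M > 0" "\<And>z. norm (f z) \<le> M"
proof -
  obtain M where M: "\<And>z. z \<in> \<Omega> \<Longrightarrow> norm (f z) \<le> M"
    using assms by (auto simp: Hinf_def bounded_iff)
  show ?thesis
  proof (rule that[of "max M 1"])
    show "norm (f z) \<le> max M 1" for z
      using M[of z] assms by (cases "z \<in> \<Omega>") (auto simp: Hinf_def)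
  qed simp
qed

lemma HinfI:
  assumes "holomorphic_several f \<Omega>" "\<And>z. norm (f z) \<le> M" "\<And>z. z \<notin> \<Omega> \<Longrightarrow> f z = 0"
  shows "f \<in> Hinf \<Omega>"
  using assms by (auto simp: Hinf_def bounded_iff)

lemma Hinf_add: "f \<in> Hinf \<Omega> \<Longrightarrow> g \<in> Hinf \<Omega> \<Longrightarrow> (\<lambda>z. f z + g z) \<in> Hinf \<Omega>"
  by (auto simp: Hinf_def intro: holomorphic_several_add bounded_plus_comp)

lemma Hinf_mult:
  assumes "f \<in> Hinf \<Omega>" "g \<in> Hinf \<Omega>" shows "(\<lambda>z. f z * g z) \<in> Hinf \<Omega>"
proof -
  obtain M where M: "M > 0" "\<And>z. norm (f z) \<le> M" using Hinf_bounded[OF assms(1)] by blast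
  obtain M' where M': "M' > 0" "\<And>z. norm (g z) \<le> M'" using Hinf_bounded[OF assms(2)] by blast
  show ?thesis
  proof (rule HinfI)
    show "holomorphic_several (\<lambda>z. f z * g z) \<Omega>"
      using assms by (auto simp: Hinf_def intro: holomorphic_several_mult)
    show "norm (f z * g z) \<le> M * M'" for z
      unfolding norm_mult using M M' by (intro mult_mono) (auto simp: less_imp_le)
    show "f z * g z = 0" if "z \<notin> \<Omega>" for z using assms that by (simp add: Hinf_def)
  qed
qed

lemma Hinf_scale:
  assumes "f \<in> Hinf \<Omega>" shows "(\<lambda>z. c * f z) \<in> Hinf \<Omega>"
proof -
  obtain M where M: "M > 0" "\<And>z. norm (f z) \<le> M" using Hinf_bounded[OF assms] by blast
  show ?thesis
  proof (rule HinfI)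
    show "holomorphic_several (\<lambda>z. c * f z) \<Omega>"
      using assms by (auto simp: Hinf_def intro!: holomorphic_several_mult holomorphic_several_const)
    show "norm (c * f z) \<le> norm c * M" for z
      using M by (auto simp: norm_mult intro!: mult_left_mono)
    show "c * f z = 0" if "z \<notin> \<Omega>" for z using assms that by (simp add: Hinf_def)
  qed
qed

lemma Hinf_diff: "f \<in> Hinf \<Omega> \<Longrightarrow> g \<in> Hinf \<Omega> \<Longrightarrow> (\<lambda>z. f z - g z) \<in> Hinf \<Omega>"
  using Hinf_add[OF _ Hinf_scale[of g \<Omega> "-1"], of f] by simp

lemma Hinf_indicator:
  assumes "open \<Omega>" shows "indicator \<Omega> \<in> Hinf \<Omega>"
proof (rule HinfI)
  show "holomorphic_several (indicator \<Omega>) \<Omega>"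
    by (rule holomorphic_several_cong[OF holomorphic_several_const[of 1] assms]) simp
  show "norm (indicator \<Omega> z :: complex) \<le> 1" for z by (simp add: indicator_def)
qed simp

lemma Hinf_subalgebra_Hinf: "open \<Omega> \<Longrightarrow> Hinf_subalgebra \<Omega> (Hinf \<Omega>)"
  by (auto simp: Hinf_subalgebra_def intro: Hinf_indicator Hinf_add Hinf_mult Hinf_scale)

lemma Hinf_subalgebra_closed_algebra_generated:
  assumes "open \<Omega>" "A \<subseteq> Hinf \<Omega>"
  shows "Hinf_subalgebra \<Omega> (closed_algebra_generated \<Omega> A)"
proof -
  let ?F = "{B. Hinf_subalgebra \<Omega> B \<and> Hinf_norm_closed \<Omega> B \<and> A \<subseteq> B}"
  \<comment> \<open>The family being intersected is nonempty, which places the intersection inside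
    \<open>Hinf \<Omega>\<close>.\<close>
  have "Hinf \<Omega> \<in> ?F"
    using assms Hinf_subalgebra_Hinf by (auto simp: Hinf_norm_closed_def)
  then have sub: "\<Inter>?F \<subseteq> Hinf \<Omega>" by (rule Inter_lower)
  have F: "B \<subseteq> Hinf \<Omega>" "indicator \<Omega> \<in> B"
    "f \<in> B \<Longrightarrow> g \<in> B \<Longrightarrow> (\<lambda>z. f z + g z) \<in> B" "f \<in> B \<Longrightarrow> g \<in> B \<Longrightarrow> (\<lambda>z. f z * g z) \<in> B"
    "f \<in> B \<Longrightarrow> (\<lambda>z. c * f z) \<in> B" if "B \<in> ?F" for B f g c
    using that by (auto simp: Hinf_subalgebra_def)
  show ?thesis
    unfolding closed_algebra_generated_def
    by (subst Hinf_subalgebra_def, intro conjI ballI allI sub InterI)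
       ((rule F(2), assumption), (rule F(3), assumption, (erule InterD, assumption)+),
        (rule F(4), assumption, (erule InterD, assumption)+), (rule F(5), assumption, erule InterD))
qed

lemma closed_algebra_generated_least:
  "Hinf_subalgebra \<Omega> B \<Longrightarrow> Hinf_norm_closed \<Omega> B \<Longrightarrow> A \<subseteq> B \<Longrightarrow> closed_algebra_generated \<Omega> A \<subseteq> B"
  unfolding closed_algebra_generated_def by blast

lemma norm_le_sup_norm:
  assumes "f \<in> Hinf \<Omega>" "z \<in> \<Omega>" shows "norm (f z) \<le> sup_norm \<Omega> f"
proof -
  obtain M where M: "M > 0" "\<And>z. norm (f z) \<le> M" using Hinf_bounded[OF assms(1)] by blast
  then have "bdd_above ((\<lambda>z. norm (f z)) ` \<Omega>)" by (intro bdd_aboveI[of _ M]) auto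
  then show ?thesis unfolding sup_norm_def using assms(2) by (rule cSUP_upper2) auto
qed

context theta_map
begin

section \<open>Boundary values in angle coordinates\<close>

definition radial_value :: "(complex ^ 'n \<Rightarrow> complex) \<Rightarrow> real ^ 'n \<Rightarrow> complex \<Rightarrow> bool" where
  "radial_value f x l \<longleftrightarrow> ((\<lambda>r. f (\<theta> (of_real r *s tor x))) \<longlongrightarrow> l) (at_left 1)"

lemma radial_in_domain: "0 < r \<Longrightarrow> r < 1 \<Longrightarrow> \<theta> (of_real r *s tor x) \<in> \<Omega>"
  by (rule theta_in_domain) simp

lemma continuous_theta: "continuous_on S \<theta>"
proof -
  have "continuous_on S (\<lambda>z. \<theta> z $ k)" for k
  proof (cases "ix k = CARD('n)")
    case True
    then have "(\<lambda>z. \<theta> z $ k) = (\<lambda>z. (\<Prod>i\<in>UNIV. z $ i) ^ (m div t))"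
      by (simp add: theta_def)
    then show ?thesis by (simp only:) (intro continuous_intros)
  next
    case False
    then have "(\<lambda>z. \<theta> z $ k) = (\<lambda>z. \<Sum>S | card S = ix k. \<Prod>i\<in>S. (z $ i) ^ m)"
      by (simp add: theta_def elem_sym_def)
    then show ?thesis by (simp only:) (intro continuous_intros)
  qed
  then show ?thesis
    using continuous_on_vec_lambda[of S "\<lambda>k z. \<theta> z $ k"] unfolding vec_nth_inverse by blast
qed

text \<open>The almost-everywhere statement is pulled back through the two push-forwards to the unit
  cube and then spread over the whole space by periodicity. Dilating \<open>\<theta> (tor x)\<close>
  is the same as applying \<theta> to the scaled torus point.\<close>

lemma inner_functions_radial:
  assumes "f \<in> inner_functions ix m t"
  shows "f \<in> Hinf \<Omega>" "AE x in lborel. \<exists>l. radial_value f x l \<and> norm l = 1"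
proof -
  show "f \<in> Hinf \<Omega>" using assms by (simp add: inner_functions_def)
  let ?P = "\<lambda>q. \<exists>l. has_boundary_value ix m t f q l \<and> norm l = 1"
  have tor': "(\<lambda>x. \<chi> i. cis (2 * pi * (x $ i))) = tor" by (simp add: tor_def fun_eq_iff)
  have meas: "\<theta> \<in> measurable haar_torus borel"
    unfolding haar_torus_def measurable_distr_eq1
    by (rule borel_measurable_continuous_onI[OF continuous_theta])
  have meas2: "tor \<in> measurable (restrict_space lborel (cbox (0 :: real ^ 'n) (\<chi> i. 1))) borel"
  proof (rule measurable_restrict_space1)
    show "tor \<in> measurable lborel borel"
      unfolding measurable_lborel2 by (rule borel_measurable_continuous_onI[OF continuous_tor])
  qed
  have "AE q in theta_measure ix m t. ?P q" using assms by (simp add: inner_functions_def)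
  then have "AE q in haar_torus. ?P (\<theta> q)"
    unfolding theta_measure_def by (rule AE_distrD[OF meas])
  then have "AE x in restrict_space lborel (cbox (0 :: real ^ 'n) (\<chi> i. 1)). ?P (\<theta> (tor x))"
    unfolding haar_torus_def tor' by (rule AE_distrD[OF meas2])
  moreover have "cbox (0 :: real ^ 'n) (\<chi> i. 1) \<inter> space lborel \<in> sets lborel" by simp
  ultimately have "AE x in lborel. x \<in> cbox 0 (\<chi> i. 1) \<longrightarrow> ?P (\<theta> (tor x))"
    by (simp only: AE_restrict_space_iff)
  then have "AE x in lborel. ?P (\<theta> (tor x))"
    by (rule AE_lborel_periodic) (simp add: tor_periodic)
  then show "AE x in lborel. \<exists>l. radial_value f x l \<and> norm l = 1"
    by (simp add: has_boundary_value_def theta_dilate_theta radial_value_def)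
qed

lemma radial_value_add: "radial_value f x a \<Longrightarrow> radial_value g x b \<Longrightarrow> radial_value (\<lambda>z. f z + g z) x (a + b)"
  unfolding radial_value_def by (rule tendsto_add)

lemma radial_value_mult: "radial_value f x a \<Longrightarrow> radial_value g x b \<Longrightarrow> radial_value (\<lambda>z. f z * g z) x (a * b)"
  unfolding radial_value_def by (rule tendsto_mult)

lemma radial_value_diff: "radial_value f x a \<Longrightarrow> radial_value g x b \<Longrightarrow> radial_value (\<lambda>z. f z - g z) x (a - b)"
  unfolding radial_value_def by (rule tendsto_diff)

lemma radial_value_scale: "radial_value f x a \<Longrightarrow> radial_value (\<lambda>z. c * f z) x (c * a)"
  unfolding radial_value_def by (rule tendsto_mult_left)

lemma radial_value_indicator: "radial_value (indicator \<Omega>) x 1"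
  unfolding radial_value_def
  by (rule tendsto_eventually) (rule at_left_radiiI, simp add: radial_in_domain)

lemma radial_value_bound:
  assumes "radial_value f x a" "\<And>r. 0 < r \<Longrightarrow> r < 1 \<Longrightarrow> norm (f (\<theta> (of_real r *s tor x))) \<le> M"
  shows "norm a \<le> M"
  using tendsto_upperbound[OF tendsto_norm[OF assms(1)[unfolded radial_value_def]] at_left_radiiI] assms(2)
  by simp

section \<open>Functions whose conjugate is nearly holomorphic after multiplication\<close>

definition conj_mult :: "(complex ^ 'n \<Rightarrow> complex) \<Rightarrow> (complex ^ 'n \<Rightarrow> complex) \<Rightarrow> (complex ^ 'n \<Rightarrow> complex) \<Rightarrow>
    real \<Rightarrow> real ^ 'n \<Rightarrow> bool" where
  "conj_mult f G h \<epsilon> x \<longleftrightarrow> (\<exists>a b c. radial_value f x a \<and> radial_value G x b \<and> radial_value h x c \<and>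
      norm b = 1 \<and> norm (c - b * cnj a) \<le> \<epsilon>)"

text \<open>The pair \<open>G\<close>, \<open>h\<close> may depend on \<epsilon>, so norm limits
  require no infinite products of unimodular factors.\<close>

definition conj_alg :: "(complex ^ 'n \<Rightarrow> complex) set" where
  "conj_alg = {f \<in> Hinf \<Omega>. \<forall>\<epsilon>>0. \<exists>G\<in>Hinf \<Omega>. \<exists>h\<in>Hinf \<Omega>. AE x in lborel. conj_mult f G h \<epsilon> x}"

lemma conj_algE:
  assumes "f \<in> conj_alg" "\<epsilon> > 0"
  obtains G h where "G \<in> Hinf \<Omega>" "h \<in> Hinf \<Omega>" "AE x in lborel. conj_mult f G h \<epsilon> x"
  using assms unfolding conj_alg_def by blast

text \<open>Common denominator: \<open>G * G'\<close> is still unimodular on the torus, and each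
  numerator is multiplied by the other denominator, which preserves its error.\<close>

lemma conj_alg_add:
  assumes f: "f \<in> conj_alg" and f': "f' \<in> conj_alg" shows "(\<lambda>z. f z + f' z) \<in> conj_alg"
proof -
  have "\<exists>G\<in>Hinf \<Omega>. \<exists>h\<in>Hinf \<Omega>. AE x in lborel. conj_mult (\<lambda>z. f z + f' z) G h \<epsilon> x" if "\<epsilon> > 0" for \<epsilon>
  proof -
    obtain G h where 1: "G \<in> Hinf \<Omega>" "h \<in> Hinf \<Omega>" "AE x in lborel. conj_mult f G h (\<epsilon> / 2) x"
      using conj_algE[OF f, of "\<epsilon> / 2"] \<open>\<epsilon> > 0\<close> by auto
    obtain G' h' where 2: "G' \<in> Hinf \<Omega>" "h' \<in> Hinf \<Omega>" "AE x in lborel. conj_mult f' G' h' (\<epsilon> / 2) x"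
      using conj_algE[OF f', of "\<epsilon> / 2"] \<open>\<epsilon> > 0\<close> by auto
    have G: "(\<lambda>z. G z * G' z) \<in> Hinf \<Omega>" using 1 2 by (intro Hinf_mult)
    have h: "(\<lambda>z. h z * G' z + h' z * G z) \<in> Hinf \<Omega>" using 1 2 by (intro Hinf_mult Hinf_add)
    have "AE x in lborel. conj_mult (\<lambda>z. f z + f' z) (\<lambda>z. G z * G' z) (\<lambda>z. h z * G' z + h' z * G z) \<epsilon> x"
        using 1(3) 2(3)
      proof eventually_elim
        case (elim x)
        obtain a b c where v: "radial_value f x a" "radial_value G x b" "radial_value h x c"
          "norm b = 1" "norm (c - b * cnj a) \<le> \<epsilon> / 2" using elim(1) unfolding conj_mult_def by blast
        obtain a' b' c' where v': "radial_value f' x a'" "radial_value G' x b'" "radial_value h' x c'"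
          "norm b' = 1" "norm (c' - b' * cnj a') \<le> \<epsilon> / 2" using elim(2) unfolding conj_mult_def by blast
        have "norm (c * b' + c' * b - b * b' * cnj (a + a')) = norm (b' * (c - b * cnj a) + b * (c' - b' * cnj a'))"
          by (simp add: algebra_simps)
        also have "\<dots> \<le> norm (c - b * cnj a) + norm (c' - b' * cnj a')"
          using norm_triangle_ineq[of "b' * (c - b * cnj a)" "b * (c' - b' * cnj a')"] v v'
          by (simp add: norm_mult)
        finally have "norm (c * b' + c' * b - b * b' * cnj (a + a')) \<le> \<epsilon>" using v v' by simp
        moreover have "norm (b * b') = 1" using v v' by (simp add: norm_mult)
        ultimately show ?case
          unfolding conj_mult_def using v v'
          by (intro exI[of _ "a + a'"] exI[of _ "b * b'"] exI[of _ "c * b' + c' * b"])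
             (auto intro!: radial_value_add radial_value_mult)
      qed
    then show ?thesis by (rule bexI[OF bexI[OF _ h] G])
  qed
  moreover have "(\<lambda>z. f z + f' z) \<in> Hinf \<Omega>"
    using f f' by (auto simp: conj_alg_def intro: Hinf_add)
  ultimately show ?thesis unfolding conj_alg_def by blast
qed

text \<open>Numerators and denominators multiply; the error splits into \<open>c'\<close> times the
  first error plus a term of modulus \<open>norm a\<close> times the second.\<close>

lemma conj_alg_mult:
  assumes f: "f \<in> conj_alg" and f': "f' \<in> conj_alg" shows "(\<lambda>z. f z * f' z) \<in> conj_alg"
proof -
  have Hf: "f \<in> Hinf \<Omega>" "f' \<in> Hinf \<Omega>" using f f' by (auto simp: conj_alg_def)
  obtain M where M: "M > 0" "\<And>z. norm (f z) \<le> M" using Hinf_bounded[OF Hf(1)] by blast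
  have "\<exists>G\<in>Hinf \<Omega>. \<exists>h\<in>Hinf \<Omega>. AE x in lborel. conj_mult (\<lambda>z. f z * f' z) G h \<epsilon> x" if "\<epsilon> > 0" for \<epsilon>
  proof -
    \<comment> \<open>The order matters: \<open>h'\<close> is fixed first because its bound
      \<open>M'\<close> determines the accuracy demanded of \<open>h\<close>.\<close>
    obtain G' h' where 2: "G' \<in> Hinf \<Omega>" "h' \<in> Hinf \<Omega>" "AE x in lborel. conj_mult f' G' h' (\<epsilon> / (2 * M)) x"
      using conj_algE[OF f', of "\<epsilon> / (2 * M)"] \<open>\<epsilon> > 0\<close> M by auto
    obtain M' where M': "M' > 0" "\<And>z. norm (h' z) \<le> M'" using Hinf_bounded[OF 2(2)] by blast
    obtain G h where 1: "G \<in> Hinf \<Omega>" "h \<in> Hinf \<Omega>" "AE x in lborel. conj_mult f G h (\<epsilon> / (2 * M')) x"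
      using conj_algE[OF f, of "\<epsilon> / (2 * M')"] \<open>\<epsilon> > 0\<close> M' by auto
    have G: "(\<lambda>z. G z * G' z) \<in> Hinf \<Omega>" using 1 2 by (intro Hinf_mult)
    have h: "(\<lambda>z. h z * h' z) \<in> Hinf \<Omega>" using 1 2 by (intro Hinf_mult)
    have "AE x in lborel. conj_mult (\<lambda>z. f z * f' z) (\<lambda>z. G z * G' z) (\<lambda>z. h z * h' z) \<epsilon> x"
        using 1(3) 2(3)
      proof eventually_elim
        case (elim x)
        obtain a b c where v: "radial_value f x a" "radial_value G x b" "radial_value h x c"
          "norm b = 1" "norm (c - b * cnj a) \<le> \<epsilon> / (2 * M')" using elim(1) unfolding conj_mult_def by blast
        obtain a' b' c' where v': "radial_value f' x a'" "radial_value G' x b'" "radial_value h' x c'"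
          "norm b' = 1" "norm (c' - b' * cnj a') \<le> \<epsilon> / (2 * M)" using elim(2) unfolding conj_mult_def by blast
        have nb: "norm a \<le> M" "norm c' \<le> M'"
          using radial_value_bound[OF v(1)] radial_value_bound[OF v'(3)] M(2) M'(2) by auto
        have "norm (c * c' - b * b' * cnj (a * a')) = norm (c' * (c - b * cnj a) + (b * cnj a) * (c' - b' * cnj a'))"
          by (simp add: algebra_simps)
        also have "\<dots> \<le> norm c' * norm (c - b * cnj a) + norm a * norm (c' - b' * cnj a')"
          using norm_triangle_ineq[of "c' * (c - b * cnj a)" "(b * cnj a) * (c' - b' * cnj a')"] v v'
          by (simp add: norm_mult)
        also have "\<dots> \<le> M' * (\<epsilon> / (2 * M')) + M * (\<epsilon> / (2 * M))"
          using nb v(5) v'(5) M M' by (intro add_mono mult_mono) auto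
        also have "\<dots> = \<epsilon>" using M M' by simp
        finally have "norm (c * c' - b * b' * cnj (a * a')) \<le> \<epsilon>" .
        moreover have "norm (b * b') = 1" using v v' by (simp add: norm_mult)
        ultimately show ?case
          unfolding conj_mult_def using v v'
          by (intro exI[of _ "a * a'"] exI[of _ "b * b'"] exI[of _ "c * c'"])
             (auto intro!: radial_value_mult)
      qed
    then show ?thesis by (rule bexI[OF bexI[OF _ h] G])
  qed
  moreover have "(\<lambda>z. f z * f' z) \<in> Hinf \<Omega>" using Hf by (rule Hinf_mult)
  ultimately show ?thesis unfolding conj_alg_def by blast
qed

text \<open>For unimodular boundary values \<open>f * cnj f = 1\<close>, so \<open>G = f\<close> and
  \<open>h = 1\<close> work without error.\<close>

lemma unimodular_conj_alg:
  assumes "f \<in> Hinf \<Omega>" "AE x in lborel. \<exists>l. radial_value f x l \<and> norm l = 1"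
  shows "f \<in> conj_alg"
proof -
  have "AE x in lborel. conj_mult f f (indicator \<Omega>) \<epsilon> x" if "\<epsilon> > 0" for \<epsilon>
    using assms(2)
  proof eventually_elim
    case (elim x)
    then obtain l where l: "radial_value f x l" "norm l = 1" by blast
    have "1 - l * cnj l = 0"
      using l(2) complex_norm_square[of l] by simp
    then show ?case
      unfolding conj_mult_def using l radial_value_indicator that
      by (intro exI[of _ l] exI[of _ 1]) auto
  qed
  then show ?thesis
    unfolding conj_alg_def using assms(1) Hinf_indicator[OF open_theta_domain] by blast
qed

lemma conj_alg_scale:
  assumes "f \<in> conj_alg" shows "(\<lambda>z. k * f z) \<in> conj_alg"
proof -
  have "\<exists>G\<in>Hinf \<Omega>. \<exists>h\<in>Hinf \<Omega>. AE x in lborel. conj_mult (\<lambda>z. k * f z) G h \<epsilon> x" if "\<epsilon> > 0" for \<epsilon>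
  proof -
    \<comment> \<open>Adding 1 keeps the divisor positive when \<open>k = 0\<close>.\<close>
    have k0: "norm k + 1 > 0" by (intro add_nonneg_pos) auto
    then have pos: "\<epsilon> / (norm k + 1) > 0" using that by (intro divide_pos_pos)
    obtain G h where 1: "G \<in> Hinf \<Omega>" "h \<in> Hinf \<Omega>" "AE x in lborel. conj_mult f G h (\<epsilon> / (norm k + 1)) x"
      by (rule conj_algE[OF assms pos])
    have h: "(\<lambda>z. cnj k * h z) \<in> Hinf \<Omega>" using 1 by (intro Hinf_scale)
    have "AE x in lborel. conj_mult (\<lambda>z. k * f z) G (\<lambda>z. cnj k * h z) \<epsilon> x"
        using 1(3)
      proof eventually_elim
        case (elim x)
        then obtain a b c where v: "radial_value f x a" "radial_value G x b" "radial_value h x c"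
          "norm b = 1" "norm (c - b * cnj a) \<le> \<epsilon> / (norm k + 1)" unfolding conj_mult_def by blast
        have "norm (cnj k * c - b * cnj (k * a)) = norm (cnj k * (c - b * cnj a))"
          by (simp add: algebra_simps)
        also have "\<dots> = norm k * norm (c - b * cnj a)" by (simp add: norm_mult)
        also have "\<dots> \<le> norm k * (\<epsilon> / (norm k + 1))" using v by (intro mult_left_mono) auto
        also have "\<dots> \<le> (norm k + 1) * (\<epsilon> / (norm k + 1))" using pos by (intro mult_right_mono) auto
        also have "\<dots> = \<epsilon>" using k0 by simp
        finally show ?case
          unfolding conj_mult_def using v
          by (intro exI[of _ "k * a"] exI[of _ b] exI[of _ "cnj k * c"]) (auto intro!: radial_value_scale)
      qed
    then show ?thesis by (rule bexI[OF bexI[OF _ h] 1(1)])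
  qed
  moreover have "(\<lambda>z. k * f z) \<in> Hinf \<Omega>"
    using assms by (auto simp: conj_alg_def intro: Hinf_scale)
  ultimately show ?thesis unfolding conj_alg_def by blast
qed

lemma Hinf_subalgebra_conj_alg: "Hinf_subalgebra \<Omega> conj_alg"
proof -
  have "indicator \<Omega> \<in> conj_alg"
    by (rule unimodular_conj_alg[OF Hinf_indicator[OF open_theta_domain]])
       (use radial_value_indicator norm_one in blast)
  moreover have "conj_alg \<subseteq> Hinf \<Omega>" by (auto simp: conj_alg_def)
  ultimately show ?thesis
    unfolding Hinf_subalgebra_def using conj_alg_add conj_alg_mult conj_alg_scale by blast
qed

lemma Hinf_norm_closed_conj_alg: "Hinf_norm_closed \<Omega> conj_alg"
  unfolding Hinf_norm_closed_def
proof (intro ballI impI)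
  fix f assume f: "f \<in> Hinf \<Omega>" and appr: "\<forall>\<epsilon>>0. \<exists>g\<in>conj_alg. sup_norm \<Omega> (\<lambda>z. f z - g z) < \<epsilon>"
  have close: "\<exists>g\<in>conj_alg. \<forall>x r. 0 < r \<longrightarrow> r < 1 \<longrightarrow>
      norm (f (\<theta> (of_real r *s tor x)) - g (\<theta> (of_real r *s tor x))) \<le> \<epsilon>" if "\<epsilon> > 0" for \<epsilon>
  proof -
    obtain g where g: "g \<in> conj_alg" "sup_norm \<Omega> (\<lambda>z. f z - g z) < \<epsilon>" using appr \<open>\<epsilon> > 0\<close> by blast
    have "g \<in> Hinf \<Omega>" using g by (simp add: conj_alg_def)
    then have "norm (f z - g z) \<le> \<epsilon>" if "z \<in> \<Omega>" for z
      using norm_le_sup_norm[OF Hinf_diff[OF f] that, of g] g(2) by simp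
    then show ?thesis using g(1) radial_in_domain by blast
  qed
  have "\<exists>g\<in>conj_alg. \<forall>x r. 0 < r \<longrightarrow> r < 1 \<longrightarrow>
      norm (f (\<theta> (of_real r *s tor x)) - g (\<theta> (of_real r *s tor x))) \<le> 1 / (real n + 1)" for n
    by (intro close) simp
  then obtain g where g: "\<And>n. g n \<in> conj_alg" "\<And>n x r. 0 < r \<Longrightarrow> r < 1 \<Longrightarrow>
      norm (f (\<theta> (of_real r *s tor x)) - g n (\<theta> (of_real r *s tor x))) \<le> 1 / (real n + 1)"
    by metis
  \<comment> \<open>Membership in the class includes radial limits almost everywhere; one null set
    for all \<open>n\<close> passes their existence on to \<open>f\<close>.\<close>
  have "AE x in lborel. \<exists>a. radial_value (g n) x a" for n
  proof -
    obtain G h where "AE x in lborel. conj_mult (g n) G h 1 x"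
      by (rule conj_algE[OF g(1)[of n] zero_less_one])
    then show ?thesis by eventually_elim (auto simp: conj_mult_def)
  qed
  then have "AE x in lborel. \<forall>n. \<exists>a. radial_value (g n) x a" by (simp add: AE_all_countable)
  then have lim: "AE x in lborel. \<exists>a. radial_value f x a"
  proof eventually_elim
    case (elim x)
    then obtain a where "\<And>n. radial_value (g n) x (a n)" by metis
    then show ?case
      unfolding radial_value_def
      by (intro tendsto_of_uniform_approx[where g = "\<lambda>n r. g n (\<theta> (of_real r *s tor x))"] at_left_radiiI g(2))
         auto
  qed
  have "\<exists>G\<in>Hinf \<Omega>. \<exists>h\<in>Hinf \<Omega>. AE x in lborel. conj_mult f G h \<epsilon> x" if "\<epsilon> > 0" for \<epsilon>
  proof -
    have e2: "\<epsilon> / 2 > 0" using that by simp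
    obtain g where g: "g \<in> conj_alg" "\<And>x r. 0 < r \<Longrightarrow> r < 1 \<Longrightarrow>
        norm (f (\<theta> (of_real r *s tor x)) - g (\<theta> (of_real r *s tor x))) \<le> \<epsilon> / 2"
      using close[OF e2] by metis
    obtain G h where 1: "G \<in> Hinf \<Omega>" "h \<in> Hinf \<Omega>" "AE x in lborel. conj_mult g G h (\<epsilon> / 2) x"
      by (rule conj_algE[OF g(1) e2])
    \<comment> \<open>The pair of the approximant also serves \<open>f\<close>: replacing
      \<open>a\<close> by \<open>a'\<close> costs at most another \<open>\<epsilon> / 2\<close>,
      because \<open>norm b = 1\<close>.\<close>
    have "AE x in lborel. conj_mult f G h \<epsilon> x"
      using 1(3) lim
    proof eventually_elim
      case (elim x)
      then obtain a b c where v: "radial_value g x a" "radial_value G x b" "radial_value h x c"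
          "norm b = 1" "norm (c - b * cnj a) \<le> \<epsilon> / 2" unfolding conj_mult_def by blast
      obtain a' where a': "radial_value f x a'" using elim by blast
      have "norm (a' - a) \<le> \<epsilon> / 2"
        by (rule radial_value_bound[OF radial_value_diff[OF a' v(1)]]) (rule g(2))
      moreover have "norm (c - b * cnj a') \<le> norm (c - b * cnj a) + norm (b * cnj (a - a'))"
        using norm_triangle_ineq[of "c - b * cnj a" "b * cnj (a - a')"] by (simp add: algebra_simps)
      moreover have "norm (b * cnj (a - a')) = norm (a' - a)"
        unfolding norm_mult complex_mod_cnj v(4) by (simp add: norm_minus_commute)
      ultimately have "norm (c - b * cnj a') \<le> \<epsilon>" using v(5) by linarith
      then show ?case unfolding conj_mult_def using v a' by blast
    qed
    then show ?thesis using 1 by blast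
  qed
  then show "f \<in> conj_alg" unfolding conj_alg_def using f by blast
qed

lemma closed_algebra_generated_inner_subset:
  "closed_algebra_generated \<Omega> (inner_functions ix m t) \<subseteq> conj_alg"
  by (intro closed_algebra_generated_least Hinf_subalgebra_conj_alg Hinf_norm_closed_conj_alg subsetI
      unimodular_conj_alg inner_functions_radial)

end

section \<open>Plateau functions\<close>

text \<open>The polynomial is a high power of \<open>1 - (y - q)\<^sup>2\<close>.\<close>

lemma peak_polynomial:
  fixes q :: real
  assumes q: "q \<in> {0..1}" and "\<delta> > 0" "e > 0"
  obtains p where "\<And>y. y \<in> {0..1} \<Longrightarrow> 0 \<le> poly p y \<and> poly p y \<le> 1" "poly p q = 1"
    "\<And>y. y \<in> {0..1} \<Longrightarrow> \<bar>y - q\<bar> \<ge> \<delta> \<Longrightarrow> poly p y \<le> e"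
proof -
  \<comment> \<open>Taking the maximum with 0 keeps the base nonnegative when
    \<open>\<delta> > 1\<close>.\<close>
  have "max 0 (1 - \<delta>\<^sup>2) < 1" using \<open>\<delta> > 0\<close> by simp
  then obtain M where M: "max 0 (1 - \<delta>\<^sup>2) ^ M < e"
    using real_arch_pow_inv[OF \<open>e > 0\<close>] by blast
  define p where "p = [:1 - q\<^sup>2, 2 * q, -1:] ^ M"
  have p: "poly p y = (1 - (y - q)\<^sup>2) ^ M" for y
    by (simp add: p_def poly_power power2_eq_square algebra_simps)
  have sq: "(y - q)\<^sup>2 \<le> 1" if "y \<in> {0..1}" for y
    using that q by (intro abs_square_le_1[THEN iffD2]) auto
  show ?thesis
  proof
    show "0 \<le> poly p y \<and> poly p y \<le> 1" if "y \<in> {0..1}" for y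
      using sq[OF that] by (auto simp: p intro: power_le_one)
    show "poly p q = 1" by (simp add: p)
    fix y assume y: "y \<in> {0..1}" "\<bar>y - q\<bar> \<ge> \<delta>"
    have "\<delta>\<^sup>2 \<le> (y - q)\<^sup>2" using y(2) \<open>\<delta> > 0\<close> by (intro abs_le_square_iff[THEN iffD1]) auto
    then have "poly p y \<le> max 0 (1 - \<delta>\<^sup>2) ^ M"
      unfolding p using sq[OF y(1)] by (intro power_mono) auto
    then show "poly p y \<le> e" using M by simp
  qed
qed

lemma countable_cos_level:
  fixes \<beta> :: real
  assumes "\<beta> \<noteq> 0" shows "countable {t. cos (\<alpha> + \<beta> * t) = k}"
proof (cases "\<exists>s. cos s = k")
  case True
  then obtain s where s: "cos s = k" by blast
  have "t \<in> range (\<lambda>n. (s + 2 * of_int n * pi - \<alpha>) / \<beta>) \<union> range (\<lambda>n. (- s + 2 * of_int n * pi - \<alpha>) / \<beta>)"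
    if "cos (\<alpha> + \<beta> * t) = k" for t
  proof -
    have "cos (\<alpha> + \<beta> * t) = cos s" using s that by simp
    then obtain n where "n \<in> \<int>" "\<alpha> + \<beta> * t = s + 2 * n * pi \<or> \<alpha> + \<beta> * t = - s + 2 * n * pi"
      unfolding cos_eq by auto
    then obtain n :: int where "\<alpha> + \<beta> * t = s + 2 * of_int n * pi \<or> \<alpha> + \<beta> * t = - s + 2 * of_int n * pi"
      by (auto elim!: Ints_cases)
    then have "t = (s + 2 * of_int n * pi - \<alpha>) / \<beta> \<or> t = (- s + 2 * of_int n * pi - \<alpha>) / \<beta>"
      using assms by (auto simp: field_simps)
    then show ?thesis by blast
  qed
  then have "{t. cos (\<alpha> + \<beta> * t) = k} \<subseteq>
      range (\<lambda>n. (s + 2 * of_int n * pi - \<alpha>) / \<beta>) \<union> range (\<lambda>n. (- s + 2 * of_int n * pi - \<alpha>) / \<beta>)"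
    by blast
  then show ?thesis by (rule countable_subset) auto
next
  case False
  then have "{t. cos (\<alpha> + \<beta> * t) = k} = {}" by auto
  then show ?thesis by simp
qed

lemma AE_lborel_cos_neq:
  fixes \<beta> :: real
  assumes "\<beta> \<noteq> 0" shows "AE t in lborel. cos (\<alpha> + \<beta> * t) \<noteq> k"
proof -
  have "{t. cos (\<alpha> + \<beta> * t) = k} \<in> null_sets lborel"
    by (rule countable_imp_null_set_lborel[OF countable_cos_level[OF assms]])
  then show ?thesis using AE_not_in by fastforce
qed

text \<open>
  The telescoping identity \<open>\<Sum>j<n. p\<^sub>j (1 - p\<^sub>0) \<cdots> (1 - p\<^sub>j\<^sub>-\<^sub>1) = 1 - (1 - p\<^sub>0) \<cdots> (1 - p\<^sub>n\<^sub>-\<^sub>1)\<close> keeps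
  the sum of infinitely many nonnegative polynomials below \<open>1\<close>.
\<close>

lemma plateau_series_exists:
  fixes Y :: "real ^ 'n::finite \<Rightarrow> real"
  assumes Y: "\<And>x. Y x \<in> {0..1}" and cont: "continuous_on UNIV Y"
    and null: "\<And>c. AE x in lborel. Y x \<noteq> c"
  obtains u :: "nat \<Rightarrow> real poly"
  where "\<And>j y. y \<in> {0..1} \<Longrightarrow> 0 \<le> poly (u j) y"
    and "\<And>y. y \<in> {0..1} \<Longrightarrow> summable (\<lambda>j. poly (u j) y)"
    and "\<And>y. y \<in> {0..1} \<Longrightarrow> (\<Sum>j. poly (u j) y) \<le> 1"
    and "\<And>W. open W \<Longrightarrow> W \<noteq> {} \<Longrightarrow> \<exists>W'\<subseteq>W. open W' \<and> W' \<noteq> {} \<and> (\<forall>x\<in>W'. (\<Sum>j. poly (u j) (Y x)) \<ge> 9 / 10)"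
    and "\<not> (AE x in lborel. (\<Sum>j. poly (u j) (Y x)) > 1 / 10)"
proof -
  obtain D :: "(real ^ 'n) set" where D: "countable D" "\<And>X. open X \<Longrightarrow> X \<noteq> {} \<Longrightarrow> \<exists>d\<in>D. d \<in> X"
    using countable_dense_exists by metis
  have "D \<noteq> {}" using D(2)[of UNIV] by auto
  \<comment> \<open>The values of \<open>Y\<close> along a dense sequence; peaking at each of them
    makes the sum large near a dense set.\<close>
  define q where "q = (\<lambda>j. Y (from_nat_into D j))"
  let ?Q = "cbox (0 :: real ^ 'n) (\<chi> i. 1)"
  have cube: "emeasure lborel ?Q = 1"
  proof -
    have ne: "?Q \<noteq> {}" by (simp add: interval_ne_empty_cart)
    have "emeasure lborel ?Q = ennreal (measure lborel ?Q)"
      by (rule emeasure_eq_ennreal_measure) (use emeasure_lborel_cbox_finite[of "0 :: real ^ 'n" "\<chi> i. 1"] in auto)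
    also have "measure lborel ?Q = 1" by (simp add: content_cbox_cart[OF ne])
    finally show ?thesis by simp
  qed
  define A where "A = (\<lambda>j \<delta>. {x \<in> ?Q. \<bar>Y x - q j\<bar> < \<delta>})"
  have Ymeas: "Y \<in> borel_measurable borel" using cont by (rule borel_measurable_continuous_onI)
  have Ameas: "A j \<delta> \<in> sets borel" for j \<delta>
    unfolding A_def using Ymeas by measurable
  \<comment> \<open>The sets decrease to a level set of \<open>Y\<close>, which is null. The chosen
    bounds sum to 1/2, less than the measure of the cube.\<close>
  have "\<exists>\<delta>>0. emeasure lborel (A j \<delta>) < ennreal ((1 / 2) ^ (j + 2))" for j
  proof -
    have "(\<lambda>n. emeasure lborel (A j (1 / real (Suc n)))) \<longlonglongrightarrow> emeasure lborel (\<Inter>n. A j (1 / real (Suc n)))"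
    proof (rule Lim_emeasure_decseq)
      show "range (\<lambda>n. A j (1 / real (Suc n))) \<subseteq> sets lborel" using Ameas by auto
      show "decseq (\<lambda>n. A j (1 / real (Suc n)))"
        unfolding decseq_def A_def by (auto elim!: order_less_le_trans intro!: frac_le)
      have "emeasure lborel (A j \<delta>) \<le> emeasure lborel ?Q" for \<delta>
        by (intro emeasure_mono) (auto simp: A_def)
      then show "emeasure lborel (A j (1 / real (Suc n))) \<noteq> \<infinity>" for n
        unfolding cube by (metis ennreal_one_less_top infinity_ennreal_def linorder_not_less)
    qed
    moreover have "emeasure lborel (\<Inter>n. A j (1 / real (Suc n))) = 0"
    proof -
      have "AE x in lborel. \<not> x \<in> (\<Inter>n. A j (1 / real (Suc n)))"
        using null[of "q j"]
      proof eventually_elim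
        case (elim x)
        then obtain n where "1 / real (Suc n) < \<bar>Y x - q j\<bar>"
          using reals_Archimedean[of "\<bar>Y x - q j\<bar>"] by (auto simp: inverse_eq_divide)
        then show ?case by (auto simp: A_def intro!: exI[of _ n])
      qed
      then have "emeasure lborel {x \<in> space lborel. x \<in> (\<Inter>n. A j (1 / real (Suc n)))} = 0"
        by (rule emeasure_eq_0_AE)
      then show ?thesis by (simp only: space_lborel space_borel UNIV_I simp_thms Collect_mem_eq)
    qed
    ultimately have lim: "(\<lambda>n. emeasure lborel (A j (1 / real (Suc n)))) \<longlonglongrightarrow> 0" by simp
    have "\<forall>\<^sub>F n in sequentially. emeasure lborel (A j (1 / real (Suc n))) < ennreal ((1 / 2) ^ (j + 2))"
      by (rule order_tendstoD(2)[OF lim]) simp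
    then obtain n where "emeasure lborel (A j (1 / real (Suc n))) < ennreal ((1 / 2) ^ (j + 2))"
      using eventually_happens'[OF sequentially_bot] by blast
    then show ?thesis by (intro exI[of _ "1 / real (Suc n)"]) auto
  qed
  then obtain \<delta> where \<delta>: "\<And>j. \<delta> j > 0" "\<And>j. emeasure lborel (A j (\<delta> j)) < ennreal ((1 / 2) ^ (j + 2))"
    by metis
  \<comment> \<open>Outside all the sets \<open>A j (\<delta> j)\<close> the peaks add up to at most
    \<open>2 / 20 = 1 / 10\<close>.\<close>
  have "\<exists>p. (\<forall>y\<in>{0..1}. 0 \<le> poly p y \<and> poly p y \<le> 1) \<and> poly p (q j) = 1 \<and>
      (\<forall>y\<in>{0..1}. \<bar>y - q j\<bar> \<ge> \<delta> j \<longrightarrow> poly p y \<le> (1 / 2) ^ j / 20)" for j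
  proof -
    have "q j \<in> {0..1}" "(1 / 2 :: real) ^ j / 20 > 0" using Y by (simp_all add: q_def)
    from peak_polynomial[OF this(1) \<delta>(1)[of j] this(2)] show ?thesis by metis
  qed
  then obtain p :: "nat \<Rightarrow> real poly" where p: "\<And>j y. y \<in> {0..1} \<Longrightarrow> 0 \<le> poly (p j) y" "\<And>j y. y \<in> {0..1} \<Longrightarrow> poly (p j) y \<le> 1"
    "\<And>j. poly (p j) (q j) = 1"
    "\<And>j y. y \<in> {0..1} \<Longrightarrow> \<bar>y - q j\<bar> \<ge> \<delta> j \<Longrightarrow> poly (p j) y \<le> (1 / 2) ^ j / 20"
    by metis
  define u where "u = (\<lambda>j. p j * (\<Prod>i<j. 1 - p i))"
  have u: "poly (u j) y = poly (p j) y * (\<Prod>i<j. 1 - poly (p i) y)" for j y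
    by (simp add: u_def poly_prod)
  have pr: "0 \<le> (\<Prod>i<j. 1 - poly (p i) y)" "(\<Prod>i<j. 1 - poly (p i) y) \<le> 1" if "y \<in> {0..1}" for j y
    using p(1,2)[OF that] by (auto intro!: prod_nonneg prod_le_1)
  have u0: "0 \<le> poly (u j) y" if "y \<in> {0..1}" for j y
    unfolding u using p(1) pr(1) that by (intro mult_nonneg_nonneg)
  have up: "poly (u j) y \<le> poly (p j) y" if "y \<in> {0..1}" for j y
    unfolding u using p(1)[OF that] pr(2)[OF that] by (intro mult_left_le) auto
  have tele: "(\<Sum>j<n. poly (u j) y) = 1 - (\<Prod>i<n. 1 - poly (p i) y)" for n y
    by (induction n) (auto simp: u algebra_simps)
  have part: "(\<Sum>j<n. poly (u j) y) \<le> 1" if "y \<in> {0..1}" for n y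
    unfolding tele using pr(1)[OF that] by simp
  have summ: "summable (\<lambda>j. poly (u j) y)" if "y \<in> {0..1}" for y
    by (rule summableI_nonneg_bounded[OF u0[OF that] part[OF that]])
  show ?thesis
  proof
    show "0 \<le> poly (u j) y" if "y \<in> {0..1}" for j y using u0[OF that] .
    show "summable (\<lambda>j. poly (u j) y)" if "y \<in> {0..1}" for y using summ[OF that] .
    show "(\<Sum>j. poly (u j) y) \<le> 1" if "y \<in> {0..1}" for y
      by (rule suminf_le_const[OF summ[OF that] part[OF that]])
    fix W :: "(real ^ 'n) set" assume W: "open W" "W \<noteq> {}"
    then obtain d where d: "d \<in> D" "d \<in> W" using D(2) by blast
    then obtain j where j: "from_nat_into D j = d"
      using from_nat_into_surj[OF D(1)] by blast
    have "continuous_on UNIV (\<lambda>x. poly (p j) (Y x))"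
      by (intro continuous_intros cont)
    then have "open {x. 9 / 10 < poly (p j) (Y x)}"
      by (intro open_Collect_less continuous_on_const)
    then have "open (W \<inter> {x. 9 / 10 < poly (p j) (Y x)})" using W by blast
    moreover have "d \<in> W \<inter> {x. 9 / 10 < poly (p j) (Y x)}"
      using d p(3)[of j] by (simp add: q_def j)
    moreover have "(\<Sum>j. poly (u j) (Y x)) \<ge> 9 / 10" if "9 / 10 < poly (p j) (Y x)" for x
    proof -
      \<comment> \<open>Where \<open>p j\<close> exceeds 9/10 the telescoped remainder is below
        1/10, whatever the earlier factors are.\<close>
      have "(\<Prod>i<j. 1 - poly (p i) (Y x)) * (1 - poly (p j) (Y x)) \<le> 1 * (1 - poly (p j) (Y x))"
        using pr(2)[OF Y] p(2)[OF Y] by (intro mult_right_mono) auto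
      then have "9 / 10 \<le> (\<Sum>j<Suc j. poly (u j) (Y x))"
        unfolding tele using that by simp
      also have "\<dots> \<le> (\<Sum>j. poly (u j) (Y x))"
        by (rule sum_le_suminf[OF summ[OF Y]]) (use u0[OF Y] in auto)
      finally show ?thesis .
    qed
    ultimately show "\<exists>W'\<subseteq>W. open W' \<and> W' \<noteq> {} \<and> (\<forall>x\<in>W'. (\<Sum>j. poly (u j) (Y x)) \<ge> 9 / 10)"
      by (intro exI[of _ "W \<inter> {x. 9 / 10 < poly (p j) (Y x)}"]) blast
  next
    show "\<not> (AE x in lborel. (\<Sum>j. poly (u j) (Y x)) > 1 / 10)"
    proof
      assume AE: "AE x in lborel. (\<Sum>j. poly (u j) (Y x)) > 1 / 10"
      \<comment> \<open>Points of the cube with sum above 1/10 lie in the exceptional sets, whose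
        total measure is at most 1/2; they cannot fill the cube up to a null set.\<close>
      have sub: "x \<in> (\<Union>j. A j (\<delta> j))" if x: "x \<in> ?Q" and U: "(\<Sum>j. poly (u j) (Y x)) > 1 / 10" for x
      proof (rule ccontr)
        assume "x \<notin> (\<Union>j. A j (\<delta> j))"
        then have "poly (p j) (Y x) \<le> (1 / 2) ^ j / 20" for j
          using x by (intro p(4)[OF Y]) (auto simp: A_def not_less)
        then have le: "poly (u j) (Y x) \<le> (1 / 2) ^ j / 20" for j
          using up[OF Y] order_trans by blast
        have s: "(\<lambda>j. (1 / 2 :: real) ^ j / 20) sums (2 / 20)"
          using sums_divide[OF geometric_sums[of "1 / 2 :: real"], of 20] by simp
        have "(\<Sum>j. poly (u j) (Y x)) \<le> (\<Sum>j. (1 / 2) ^ j / 20)"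
          using le by (intro suminf_le summ[OF Y] sums_summable[OF s])
        then show False using U sums_unique[OF s] by simp
      qed
      have "emeasure lborel ?Q \<le> emeasure lborel (\<Union>j. A j (\<delta> j))"
        by (rule emeasure_mono_AE) (use AE sub Ameas in \<open>auto elim!: eventually_mono\<close>)
      also have "\<dots> \<le> (\<Sum>j. emeasure lborel (A j (\<delta> j)))"
        using Ameas by (intro emeasure_subadditive_countably) auto
      also have "\<dots> \<le> (\<Sum>j. ennreal ((1 / 2) ^ (j + 2)))"
        using \<delta>(2) by (intro suminf_le) (auto simp: less_imp_le)
      also have "\<dots> = ennreal (\<Sum>j. (1 / 2) ^ (j + 2))"
        by (rule suminf_ennreal2) (auto intro!: summable_ignore_initial_segment[where k = 2] summable_geometric)
      also have "(\<Sum>j. (1 / 2 :: real) ^ (j + 2)) = 1 / 2"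
        using suminf_mult[OF summable_geometric[of "1 / 2 :: real"], of "1 / 4"] suminf_geometric[of "1 / 2 :: real"]
        by (simp add: power_add)
      finally have "ennreal 1 \<le> ennreal (1 / 2)" by (simp only: cube ennreal_1)
      then show False by (subst (asm) ennreal_le_iff) auto
    qed
  qed
qed

context theta_map
begin

text \<open>Two applications of Fubini. Moving coordinate \<open>k\<close> shows that the sum
  \<open>A x i\<close> of the remaining unit vectors is almost never 0. Moving coordinate
  \<open>i\<close> then makes \<open>Y\<close> a nonconstant affine function of a cosine, which
  takes a given value only countably often.\<close>

lemma AE_Y_neq: "AE x in lborel. Y x \<noteq> c"
proof -
  define e where "e = (\<lambda>x::real ^ 'n. \<lambda>i. cis (2 * pi * m * x $ i))"
  define A where "A = (\<lambda>x i. \<Sum>k\<in>UNIV - {i}. e x k)"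
  obtain i k :: 'n where ik: "i \<noteq> k"
    using card by (metis One_nat_def card_1_singleton_iff UNIV_eq_I insertCI less_irrefl singletonD)
  have m0: "2 * pi * real m \<noteq> 0" using m by simp
  have e_shift: "e (x + t *\<^sub>R axis l 1) l = cis (2 * pi * m * x $ l + 2 * pi * m * t)"
    "j \<noteq> l \<Longrightarrow> e (x + t *\<^sub>R axis l 1) j = e x j" for x t l j
    by (simp_all add: e_def axis_def algebra_simps)
  have contA: "continuous_on UNIV (\<lambda>x. A x i)"
    unfolding A_def e_def by (intro continuous_intros)
  have "AE x in lborel. x \<notin> {x. A x i = 0}"
  proof (rule AE_lborel_of_lines[where v = "axis k 1"])
    have "closed {x. A x i = 0}" using contA by (intro closed_Collect_eq continuous_intros)
    then show "{x. A x i = 0} \<in> sets borel" by (rule borel_closed)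
    show "AE x in lborel. AE t in lborel. x + t *\<^sub>R axis k 1 \<notin> {x. A x i = 0}"
    proof (rule AE_I2)
      fix x
      define B where "B = (\<Sum>l\<in>UNIV - {i} - {k}. e x l)"
      have "A (x + t *\<^sub>R axis k 1) i = cis (2 * pi * m * x $ k + 2 * pi * m * t) + B" for t
        unfolding A_def B_def using ik
        by (subst sum.remove[of _ k]) (auto simp: e_shift intro!: sum.cong)
      then have Re: "Re (A (x + t *\<^sub>R axis k 1) i) = cos (2 * pi * m * x $ k + 2 * pi * m * t) + Re B" for t
        by simp
      have "AE t in lborel. cos (2 * pi * m * x $ k + 2 * pi * m * t) \<noteq> - Re B"
        by (rule AE_lborel_cos_neq[OF m0])
      then show "AE t in lborel. x + t *\<^sub>R axis k 1 \<notin> {x. A x i = 0}"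
      proof eventually_elim
        case (elim t)
        then have "Re (A (x + t *\<^sub>R axis k 1) i) \<noteq> 0" by (simp add: Re)
        then show ?case by auto
      qed
    qed
  qed
  moreover have "AE x in lborel. x \<notin> {x. A x i \<noteq> 0 \<and> Y x = c}"
  proof (rule AE_lborel_of_lines[where v = "axis i 1"])
    have "closed {x. A x i = 0}" using contA by (intro closed_Collect_eq continuous_intros)
    moreover have "closed {x. Y x = c}"
      using continuous_Y by (intro closed_Collect_eq continuous_intros)
    moreover have "{x. A x i \<noteq> 0 \<and> Y x = c} = {x. Y x = c} - {x. A x i = 0}" by auto
    ultimately show "{x. A x i \<noteq> 0 \<and> Y x = c} \<in> sets borel" by (simp add: borel_closed sets.Diff)
    show "AE x in lborel. AE t in lborel. x + t *\<^sub>R axis i 1 \<notin> {x. A x i \<noteq> 0 \<and> Y x = c}"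
    proof (rule AE_I2)
      fix x
      have A_shift: "A (x + t *\<^sub>R axis i 1) i = A x i" for t
        unfolding A_def by (intro sum.cong) (auto simp: e_shift)
      show "AE t in lborel. x + t *\<^sub>R axis i 1 \<notin> {x. A x i \<noteq> 0 \<and> Y x = c}"
      proof (cases "A x i = 0")
        case True
        then show ?thesis by (simp add: A_shift)
      next
        case False
        define a where "a = A x i"
        define \<phi> where "\<phi> = 2 * pi * m * x $ i - Arg a"
        have a: "a = norm a * cis (Arg a)" using rcis_cmod_Arg[of a] by (simp add: rcis_def)
        \<comment> \<open>The law of cosines for the sum of a rotating unit vector and the fixed
          vector \<open>a\<close>.\<close>
        have Yt: "Y (x + t *\<^sub>R axis i 1) = ((norm a)\<^sup>2 + 1 + 2 * norm a * cos (\<phi> + 2 * pi * m * t)) / 4 ^ CARD('n)" for t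
        proof -
          let ?s = "2 * pi * m * x $ i + 2 * pi * m * t"
          have "(\<Sum>l\<in>UNIV. e (x + t *\<^sub>R axis i 1) l) = cis ?s + a"
            by (subst sum.remove[of _ i]) (auto simp: e_shift a_def A_shift[of t, symmetric] A_def)
          moreover have "(norm (cis ?s + a))\<^sup>2 = (norm a)\<^sup>2 + 1 + 2 * norm a * cos (?s - Arg a)"
          proof -
            have alg: "(c + n * c')\<^sup>2 + (s + n * s')\<^sup>2 = (c\<^sup>2 + s\<^sup>2) + n\<^sup>2 * (c'\<^sup>2 + s'\<^sup>2) + 2 * n * (c * c' + s * s')"
              for c c' s s' n :: real
              by (simp add: power2_eq_square algebra_simps)
            have "(norm (cis ?s + a))\<^sup>2 = (norm (cis ?s + norm a * cis (Arg a)))\<^sup>2" using a by simp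
            also have "\<dots> = (cos ?s + norm a * cos (Arg a))\<^sup>2 + (sin ?s + norm a * sin (Arg a))\<^sup>2"
              by (simp add: cmod_power2)
            also have "\<dots> = ((cos ?s)\<^sup>2 + (sin ?s)\<^sup>2) + (norm a)\<^sup>2 * ((cos (Arg a))\<^sup>2 + (sin (Arg a))\<^sup>2)
                + 2 * norm a * (cos ?s * cos (Arg a) + sin ?s * sin (Arg a))"
              by (rule alg)
            finally show ?thesis by (simp add: cos_diff)
          qed
          ultimately show ?thesis by (simp add: Y_def e_def[symmetric] \<phi>_def algebra_simps e_def)
        qed
        have "AE t in lborel. cos (\<phi> + 2 * pi * m * t) \<noteq> (c * 4 ^ CARD('n) - (norm a)\<^sup>2 - 1) / (2 * norm a)"
          by (rule AE_lborel_cos_neq[OF m0])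
        then show ?thesis
        proof eventually_elim
          case (elim t)
          then have "Y (x + t *\<^sub>R axis i 1) \<noteq> c"
            using False unfolding Yt by (auto simp: field_simps a_def)
          then show ?case by simp
        qed
      qed
    qed
  qed
  ultimately show ?thesis by eventually_elim blast
qed

end

section \<open>A function outside the closed algebra\<close>

text \<open>Since \<open>- 2 * w / (1 - w) = 1 - (1 + w) / (1 - w)\<close>, the subtracted quotient
  is the Poisson kernel: the real part is at most 1 in the disc and equal to 1 on the circle away
  from \<open>w = 1\<close>.\<close>

lemma Re_cayley:
  assumes "w \<noteq> 1" shows "Re (- 2 * w / (1 - w)) = 1 - (1 - (norm w)\<^sup>2) / (norm (1 - w))\<^sup>2"
proof -
  have "Re (- 2 * w) * Re (1 - w) + Im (- 2 * w) * Im (1 - w) = (norm (1 - w))\<^sup>2 - (1 - (norm w)\<^sup>2)"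
    unfolding cmod_power2 by (simp add: power2_eq_square algebra_simps)
  then have "Re (- 2 * w / (1 - w)) = ((norm (1 - w))\<^sup>2 - (1 - (norm w)\<^sup>2)) / (norm (1 - w))\<^sup>2"
    by (simp only: Re_divide')
  then show ?thesis using assms by (simp add: diff_divide_distrib)
qed

lemma Re_of_real_times: "Re (of_real a * z) = a * Re z"
  by simp

lemma Re_cayley_le_1:
  assumes "norm w < 1" shows "Re (- 2 * w / (1 - w)) \<le> 1"
proof -
  have "w \<noteq> 1" using assms by auto
  have "(norm w)\<^sup>2 \<le> 1" using assms by (simp add: power_le_one)
  then show ?thesis unfolding Re_cayley[OF \<open>w \<noteq> 1\<close>] by simp
qed

context theta_map
begin

section \<open>Passing between slices and the whole domain\<close>

text \<open>The slices \<open>c *s tor x\<close> contain the torus of every radius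
  \<open>r < 1\<close>; from there the maximum modulus principle moves one coordinate at a time into
  the interior.\<close>

lemma polydisc_maximum:
  assumes f: "holomorphic_several f \<Omega>"
    and B: "\<And>x c. norm c < 1 \<Longrightarrow> norm (f (\<theta> (c *s tor x))) \<le> B"
    and q: "q \<in> \<Omega>"
  shows "norm (f q) \<le> B"
proof -
  obtain z where z: "z \<in> polydisc" "q = \<theta> z" using q by (auto simp: theta_domain_def)
  define K where "K = Max (range (\<lambda>i. norm (z $ i)))"
  have fin: "finite (range (\<lambda>i. norm (z $ i)))" by simp
  have K: "norm (z $ i) \<le> K" for i
    unfolding K_def by (rule Max_ge[OF fin]) simp
  have K1: "K < 1"
    unfolding K_def using z by (subst Max_less_iff[OF fin]) (auto simp: polydisc_def)
  have K0: "0 \<le> K" by (rule order_trans[OF norm_ge_zero K])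
  define r where "r = (K + 1) / 2"
  have r: "r < 1" "0 < r" using K0 K1 by (simp_all add: r_def)
  have zr: "norm (z $ i) \<le> r" for i
    by (rule order_trans[OF K]) (use K1 in \<open>simp add: r_def\<close>)
  \<comment> \<open>Induction on the set \<open>S\<close> of coordinates already allowed inside the
    disc of radius \<open>r\<close>, the others staying on its boundary circle.\<close>
  have "\<forall>z. (\<forall>i\<in>S. norm (z $ i) \<le> r) \<and> (\<forall>i. i \<notin> S \<longrightarrow> norm (z $ i) = r) \<longrightarrow> norm (f (\<theta> z)) \<le> B"
    if "finite S" for S
    using that
  proof (induction S rule: finite_induct)
    case empty
    show ?case
    proof (intro allI impI)
      fix z :: "complex ^ 'n"
      assume "(\<forall>i\<in>{}. norm (z $ i) \<le> r) \<and> (\<forall>i. i \<notin> {} \<longrightarrow> norm (z $ i) = r)"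
      then have nz: "norm (z $ i) = r" for i by simp
      define x :: "real ^ 'n" where "x = (\<chi> i. Arg (z $ i) / (2 * pi))"
      have "z $ i = of_real r * cis (Arg (z $ i))" for i
        using rcis_cmod_Arg[of "z $ i"] by (simp add: rcis_def nz)
      then have "z = of_real r *s tor x"
        by (simp add: vec_eq_iff tor_def x_def)
      then show "norm (f (\<theta> z)) \<le> B" using B[of "of_real r" x] r by simp
    qed
  next
    case (insert i S)
    show ?case
    proof (intro allI impI)
      fix z :: "complex ^ 'n"
      assume zz: "(\<forall>j\<in>insert i S. norm (z $ j) \<le> r) \<and> (\<forall>j. j \<notin> insert i S \<longrightarrow> norm (z $ j) = r)"
      define \<gamma> where "\<gamma> = (\<lambda>l. \<chi> k. if k = i then l else z $ k)"
      have zr: "norm (z $ j) \<le> r" for j using zz by (cases "j \<in> insert i S") auto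
      have hol\<gamma>: "(\<lambda>l. \<gamma> l $ k) holomorphic_on A" for k A
        by (cases "k = i") (auto simp: \<gamma>_def intro!: holomorphic_intros)
      have hol: "(\<lambda>l. f (\<theta> (\<gamma> l))) holomorphic_on ball 0 1"
      proof (rule holomorphic_several_along[OF f open_ball])
        show "(\<lambda>l. \<theta> (\<gamma> l) $ k) holomorphic_on ball 0 1" for k
        proof (cases "ix k = CARD('n)")
          case True
          then have "(\<lambda>l. \<theta> (\<gamma> l) $ k) = (\<lambda>l. (\<Prod>i\<in>UNIV. \<gamma> l $ i) ^ (m div t))"
            by (simp add: theta_def)
          then show ?thesis by (simp only:) (intro holomorphic_intros hol\<gamma>)
        next
          case False
          then have "(\<lambda>l. \<theta> (\<gamma> l) $ k) = (\<lambda>l. \<Sum>S | card S = ix k. \<Prod>i\<in>S. (\<gamma> l $ i) ^ m)"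
            by (simp add: theta_def elem_sym_def)
          then show ?thesis by (simp only:) (intro holomorphic_intros hol\<gamma>)
        qed
        show "\<theta> (\<gamma> l) \<in> \<Omega>" if "l \<in> ball 0 1" for l
        proof -
          have "norm (\<gamma> l $ k) < 1" for k
            using that le_less_trans[OF zr[of k] r(1)] by (simp add: \<gamma>_def)
          then have "\<gamma> l \<in> polydisc" by (simp add: polydisc_def)
          then show ?thesis by (auto simp: theta_domain_def)
        qed
      qed
      have sphere: "norm (f (\<theta> (\<gamma> l))) \<le> B" if "norm l = r" for l
      proof -
        have "(\<forall>j\<in>S. norm (\<gamma> l $ j) \<le> r) \<and> (\<forall>j. j \<notin> S \<longrightarrow> norm (\<gamma> l $ j) = r)"
          using zz that by (auto simp: \<gamma>_def)
        then show ?thesis using insert.IH by blast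
      qed
      have sub: "cball 0 r \<subseteq> ball (0::complex) 1" using r by auto
      have "norm (f (\<theta> (\<gamma> (z $ i)))) \<le> B"
      proof (rule maximum_modulus_frontier[of "\<lambda>l. f (\<theta> (\<gamma> l))" "cball 0 r"])
        show "(\<lambda>l. f (\<theta> (\<gamma> l))) holomorphic_on interior (cball 0 r)"
          using hol by (rule holomorphic_on_subset) (use sub interior_subset in blast)
        show "continuous_on (closure (cball 0 r)) (\<lambda>l. f (\<theta> (\<gamma> l)))"
          using holomorphic_on_imp_continuous_on[OF hol] sub
          by (simp only: closure_closed[OF closed_cball] continuous_on_subset)
        show "norm (f (\<theta> (\<gamma> l))) \<le> B" if "l \<in> frontier (cball 0 r)" for l
          using that r(2) by (intro sphere) (simp add: frontier_cball)
        show "z $ i \<in> cball 0 r" using zr[of i] by simp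
      qed simp
      moreover have "\<gamma> (z $ i) = z" by (simp add: \<gamma>_def vec_eq_iff)
      ultimately show "norm (f (\<theta> z)) \<le> B" by simp
    qed
  qed
  from this[OF finite, of UNIV] zr show ?thesis unfolding z(2) by simp
qed

lemma radial_value_slice:
  "radial_value f (x + \<tau> *\<^sub>R (\<chi> i. 1)) l \<longleftrightarrow>
    ((\<lambda>r. f (\<theta> ((of_real r * cis (2 * pi * \<tau>)) *s tor x))) \<longlongrightarrow> l) (at_left 1)"
  by (simp add: radial_value_def tor_shift vector_smult_assoc)

lemma holomorphic_slice:
  assumes "holomorphic_several f \<Omega>"
  shows "(\<lambda>c. f (\<theta> (c *s tor x))) holomorphic_on ball 0 1"
proof (rule holomorphic_several_along[OF assms open_ball])
  show "(\<lambda>c. \<theta> (c *s tor x) $ k) holomorphic_on ball 0 1" for k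
    by (simp add: theta_smult) (intro holomorphic_intros)
qed (auto intro: theta_in_domain)

lemma holomorphic_s_fun: "holomorphic_several s_fun A"
  unfolding s_fun_def by (intro holomorphic_several_power holomorphic_several_nth)

lemma holomorphic_v_fun: "holomorphic_several v_fun A"
proof -
  have "v_fun = (\<lambda>q. q $ idx 1 * q $ idx (CARD('n) - 1) * (1 / 4 ^ CARD('n)))"
    by (simp add: v_fun_def fun_eq_iff)
  then show ?thesis
    by (simp only:) (intro holomorphic_several_mult holomorphic_several_nth holomorphic_several_const)
qed

end

section \<open>The function with prescribed boundary modulus\<close>

locale plateau_series = theta_map ix m t for ix :: "'n::finite \<Rightarrow> nat" and m t +
  fixes u :: "nat \<Rightarrow> real poly"
  assumes u_nonneg: "\<And>j y. y \<in> {0..1} \<Longrightarrow> 0 \<le> poly (u j) y"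
    and u_summable: "\<And>y. y \<in> {0..1} \<Longrightarrow> summable (\<lambda>j. poly (u j) y)"
    and u_le_1: "\<And>y. y \<in> {0..1} \<Longrightarrow> (\<Sum>j. poly (u j) y) \<le> 1"
begin

definition U :: "real ^ 'n \<Rightarrow> real" where "U x = (\<Sum>j. poly (u j) (Y x))"

definition C :: "nat \<Rightarrow> real" where "C j = (\<Sum>k\<le>degree (u j). \<bar>coeff (u j) k\<bar>)"

text \<open>For fixed \<open>\<rho> < 1\<close> one has \<open>\<rho> < radial j\<close> for large
  \<open>j\<close>, so these exponents make the terms summable on each set
  \<open>norm (s_fun q) \<le> \<rho>\<close>.\<close>

definition gap :: "nat \<Rightarrow> nat" where
  "gap j = (SOME n. n \<ge> 1 \<and> C j * radial j ^ n \<le> (1 / 2) ^ j)"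

text \<open>All differences \<open>N j - k\<close> with \<open>k \<le> degree (u j)\<close> are then
  genuine and at least \<open>gap j\<close>.\<close>

definition N :: "nat \<Rightarrow> nat" where "N j = degree (u j) + gap j"

text \<open>
  With \<open>s = s_fun q\<close> and \<open>v = v_fun q\<close>, this is the homogenisation \<open>s\<^sup>N u\<^sub>j (v / s)\<close> of \<open>u\<^sub>j\<close>.
\<close>

definition hom :: "nat \<Rightarrow> complex ^ 'n \<Rightarrow> complex" where
  "hom j q = (\<Sum>k\<le>degree (u j). of_real (coeff (u j) k) * s_fun q ^ (N j - k) * v_fun q ^ k)"

definition term_fun :: "nat \<Rightarrow> complex ^ 'n \<Rightarrow> complex" where
  "term_fun j q = - 2 * hom j q * inverse (1 - s_fun q ^ N j)"

definition log_fun :: "complex ^ 'n \<Rightarrow> complex" where "log_fun q = (\<Sum>j. term_fun j q)"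

text \<open>The factor \<open>ln 2\<close> makes the modulus
  \<open>2 powr Re (log_fun q)\<close>.\<close>

definition F0 :: "complex ^ 'n \<Rightarrow> complex" where
  "F0 q = (if q \<in> \<Omega> then exp (of_real (ln 2) * log_fun q) else 0)"

lemma Y01: "Y x \<in> {0..1}" using Y_range by simp

lemma C_nonneg: "0 \<le> C j" by (simp add: C_def sum_nonneg)

lemma gap: "gap j \<ge> 1" "C j * radial j ^ gap j \<le> (1 / 2) ^ j"
proof -
  have "\<exists>n\<ge>1. C j * radial j ^ n \<le> (1 / 2) ^ j"
  proof -
    have "(\<lambda>n. C j * radial j ^ n) \<longlonglongrightarrow> C j * 0"
      using radial(1,2)[of j] by (intro tendsto_intros LIMSEQ_power_zero) simp
    then have "\<forall>\<^sub>F n in sequentially. C j * radial j ^ n < (1 / 2) ^ j"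
      by (rule order_tendstoD(2)) simp
    then have "\<forall>\<^sub>F n in sequentially. C j * radial j ^ n < (1 / 2) ^ j \<and> n \<ge> 1"
      by (rule eventually_conj[OF _ eventually_ge_at_top])
    then obtain n where "C j * radial j ^ n < (1 / 2) ^ j \<and> n \<ge> 1"
      using eventually_happens'[OF sequentially_bot] by blast
    then show ?thesis by (intro exI[of _ n]) simp
  qed
  from someI_ex[OF this] show "gap j \<ge> 1" "C j * radial j ^ gap j \<le> (1 / 2) ^ j"
    unfolding gap_def by auto
qed

lemma N_pos: "N j \<ge> 1" using gap(1)[of j] by (simp add: N_def)

lemma hom_bound:
  assumes s: "norm (s_fun q) \<le> \<rho>" "\<rho> \<le> 1" and v: "norm (v_fun q) \<le> 1"
  shows "norm (hom j q) \<le> C j * \<rho> ^ gap j"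
proof -
  have \<rho>: "0 \<le> \<rho>" using s(1) norm_ge_zero order_trans by blast
  have "norm (hom j q) \<le> (\<Sum>k\<le>degree (u j). \<bar>coeff (u j) k\<bar> * \<rho> ^ gap j)"
    unfolding hom_def
  proof (rule sum_norm_le)
    fix k assume "k \<in> {..degree (u j)}"
    then have k: "gap j \<le> N j - k" by (simp add: N_def)
    have "norm (of_real (coeff (u j) k) * s_fun q ^ (N j - k) * v_fun q ^ k) =
        \<bar>coeff (u j) k\<bar> * (norm (s_fun q) ^ (N j - k) * norm (v_fun q) ^ k)"
      by (simp add: norm_mult norm_power)
    also have "\<dots> \<le> \<bar>coeff (u j) k\<bar> * (\<rho> ^ gap j * 1)"
    proof (intro mult_left_mono mult_mono)
      have "norm (s_fun q) ^ (N j - k) \<le> \<rho> ^ (N j - k)" using s by (intro power_mono) auto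
      also have "\<dots> \<le> \<rho> ^ gap j" using \<rho> s(2) k by (intro power_decreasing)
      finally show "norm (s_fun q) ^ (N j - k) \<le> \<rho> ^ gap j" .
      show "norm (v_fun q) ^ k \<le> 1" using v by (simp add: power_le_one)
    qed (use \<rho> in auto)
    finally show "norm (of_real (coeff (u j) k) * s_fun q ^ (N j - k) * v_fun q ^ k) \<le> \<bar>coeff (u j) k\<bar> * \<rho> ^ gap j"
      by simp
  qed
  then show ?thesis by (simp add: C_def sum_distrib_right)
qed

definition term_bound :: "real \<Rightarrow> nat \<Rightarrow> real" where
  "term_bound \<rho> j = 2 * (C j * \<rho> ^ gap j) / (1 - \<rho>)"

lemma term_fun_bound:
  assumes s: "norm (s_fun q) \<le> \<rho>" "\<rho> < 1" and v: "norm (v_fun q) \<le> 1"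
  shows "norm (term_fun j q) \<le> term_bound \<rho> j"
proof -
  have "norm (s_fun q ^ N j) \<le> norm (s_fun q) ^ 1"
    unfolding norm_power using N_pos s by (intro power_decreasing) auto
  then have d: "1 - \<rho> \<le> norm (1 - s_fun q ^ N j)"
    using norm_triangle_ineq2[of 1 "s_fun q ^ N j"] s by simp
  have hom: "norm (hom j q) \<le> C j * \<rho> ^ gap j" using s v by (intro hom_bound) auto
  have "norm (term_fun j q) = 2 * norm (hom j q) / norm (1 - s_fun q ^ N j)"
    by (simp add: term_fun_def norm_mult norm_inverse divide_inverse)
  also have "\<dots> \<le> 2 * (C j * \<rho> ^ gap j) / (1 - \<rho>)"
    using d s hom order_trans[OF norm_ge_zero hom] by (intro frac_le mult_left_mono) auto
  finally show ?thesis by (simp add: term_bound_def)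
qed

lemma summable_term_bound:
  assumes "0 \<le> \<rho>" "\<rho> < 1" shows "summable (term_bound \<rho>)"
proof -
  have "summable (\<lambda>j. C j * \<rho> ^ gap j)"
  proof (rule summable_comparison_test_ev)
    have "\<forall>\<^sub>F j in sequentially. \<rho> < radial j"
      using assms radial(3) by (intro order_tendstoD)
    then show "\<forall>\<^sub>F j in sequentially. norm (C j * \<rho> ^ gap j) \<le> (1 / 2) ^ j"
    proof eventually_elim
      case (elim j)
      have "C j * \<rho> ^ gap j \<le> C j * radial j ^ gap j"
        using elim assms C_nonneg by (intro mult_left_mono power_mono) auto
      then show ?case using gap(2)[of j] C_nonneg[of j] assms by (simp add: abs_mult)
    qed
    show "summable (\<lambda>j. (1 / 2 :: real) ^ j)" by (rule summable_geometric) simp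
  qed
  then show ?thesis unfolding term_bound_def by (intro summable_divide summable_mult)
qed

lemma s_fun_power_neq_1: "q \<in> \<Omega> \<Longrightarrow> s_fun q ^ N j \<noteq> 1"
proof
  assume q: "q \<in> \<Omega>" and eq: "s_fun q ^ N j = 1"
  have "norm (s_fun q) ^ N j < 1"
    using s_fun_less_1[OF q] N_pos[of j] by (simp add: power_less_one_iff)
  then show False using eq by (metis less_irrefl norm_one norm_power)
qed

lemma holomorphic_term_fun: "holomorphic_several (term_fun j) \<Omega>"
  unfolding term_fun_def hom_def
  by (intro holomorphic_several_mult holomorphic_several_const holomorphic_several_sum
      holomorphic_several_power holomorphic_s_fun holomorphic_v_fun holomorphic_several_inverse
      holomorphic_several_diff) (use s_fun_power_neq_1 in auto)

lemma summable_term_fun: "q \<in> \<Omega> \<Longrightarrow> summable (\<lambda>j. term_fun j q)"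
  by (rule summable_comparison_test'[OF summable_term_bound[of "norm (s_fun q)"]])
     (use s_fun_less_1 v_fun_le_1 term_fun_bound in auto)

text \<open>The series is dominated only for \<open>norm (s_fun q)\<close> bounded away from 1; the
  sets \<open>norm (s_fun q) < \<rho>\<close> exhaust the domain.\<close>

lemma holomorphic_log_fun: "holomorphic_several log_fun \<Omega>"
proof -
  have "holomorphic_several log_fun (\<Omega> \<inter> {q. norm (s_fun q) < \<rho>})" if \<rho>: "0 \<le> \<rho>" "\<rho> < 1" for \<rho>
    unfolding log_fun_def
  proof (rule holomorphic_several_suminf[OF _ _ _ summable_term_bound[OF \<rho>]])
    have "continuous_on UNIV s_fun"
      by (rule holomorphic_several_imp_continuous_on[OF holomorphic_s_fun])
    then show "open (\<Omega> \<inter> {q. norm (s_fun q) < \<rho>})"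
      using open_theta_domain by (intro open_Int open_Collect_less continuous_intros)
    show "holomorphic_several (term_fun j) (\<Omega> \<inter> {q. norm (s_fun q) < \<rho>})" for j
      by (rule holomorphic_several_subset[OF holomorphic_term_fun]) simp
    show "norm (term_fun j q) \<le> term_bound \<rho> j" if "q \<in> \<Omega> \<inter> {q. norm (s_fun q) < \<rho>}" for j q
      using that \<rho> v_fun_le_1 by (intro term_fun_bound) auto
  qed
  moreover have "\<exists>\<rho>. 0 \<le> \<rho> \<and> \<rho> < 1 \<and> q \<in> \<Omega> \<inter> {q. norm (s_fun q) < \<rho>}" if "q \<in> \<Omega>" for q
  proof -
    have s1: "norm (s_fun q) < 1" using that by (rule s_fun_less_1)
    obtain \<rho> where "norm (s_fun q) < \<rho>" "\<rho> < 1" using dense[OF s1] by blast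
    moreover from this have "0 \<le> \<rho>" using norm_ge_zero[of "s_fun q"] by linarith
    ultimately show ?thesis using that by blast
  qed
  ultimately show ?thesis unfolding holomorphic_several_def by blast
qed

text \<open>On a slice \<open>s_fun\<close> and \<open>v_fun\<close> carry the same power of
  \<open>c\<close>, so their quotient is the constant \<open>Y x\<close> and the homogenised
  polynomial collapses to \<open>w * poly (u j) (Y x)\<close>.\<close>

lemma term_fun_slice:
  fixes j :: nat and x :: "real ^ 'n" and c :: complex
  assumes "norm c < 1"
  defines "w \<equiv> (c ^ (CARD('n) * m) * s_fun (\<theta> (tor x))) ^ N j"
  shows "term_fun j (\<theta> (c *s tor x)) = of_real (poly (u j) (Y x)) * (- 2 * w / (1 - w))"
proof -
  let ?s = "c ^ (CARD('n) * m) * s_fun (\<theta> (tor x))"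
  have s: "s_fun (\<theta> (c *s tor x)) = ?s" by (rule s_fun_smult)
  have v: "v_fun (\<theta> (c *s tor x)) = ?s * of_real (Y x)"
    by (simp add: v_fun_smult v_fun_tor)
  have "hom j (\<theta> (c *s tor x)) = (\<Sum>k\<le>degree (u j). w * of_real (coeff (u j) k * Y x ^ k))"
    unfolding hom_def s v
  proof (rule sum.cong[OF refl])
    fix k assume "k \<in> {..degree (u j)}"
    then have "N j - k + k = N j" by (simp add: N_def)
    then have "?s ^ (N j - k) * ?s ^ k = w" unfolding w_def by (simp only: power_add[symmetric])
    then show "of_real (coeff (u j) k) * ?s ^ (N j - k) * (?s * of_real (Y x)) ^ k =
        w * of_real (coeff (u j) k * Y x ^ k)"
      by (simp add: power_mult_distrib mult_ac)
  qed
  also have "\<dots> = w * of_real (poly (u j) (Y x))"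
    by (simp add: poly_altdef sum_distrib_left)
  finally show ?thesis
    by (simp add: term_fun_def s w_def divide_inverse mult_ac)
qed

lemma Re_term_fun_slice_le:
  assumes "norm c < 1"
  shows "Re (term_fun j (\<theta> (c *s tor x))) \<le> poly (u j) (Y x)"
proof -
  let ?w = "(c ^ (CARD('n) * m) * s_fun (\<theta> (tor x))) ^ N j"
  have "norm (s_fun (\<theta> (c *s tor x))) < 1" by (rule s_fun_less_1[OF theta_in_domain[OF assms]])
  then have "norm ?w < 1" using N_pos[of j] by (simp add: s_fun_smult norm_power power_less_one_iff)
  then have "Re (- 2 * ?w / (1 - ?w)) \<le> 1" by (rule Re_cayley_le_1)
  then have "poly (u j) (Y x) * Re (- 2 * ?w / (1 - ?w)) \<le> poly (u j) (Y x) * 1"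
    using u_nonneg[OF Y01] by (rule mult_left_mono)
  then show ?thesis by (simp only: term_fun_slice[OF assms] Re_of_real_times mult_1_right)
qed

text \<open>Summing the slice bound over \<open>j \<ge> J\<close>. With \<open>J = 0\<close> it
  bounds \<open>F0\<close>; general \<open>J\<close> is for the mean value argument.\<close>

lemma log_fun_tail:
  fixes x :: "real ^ 'n" and c :: complex
  assumes "norm c < 1" defines "q \<equiv> \<theta> (c *s tor x)"
  shows "Re (log_fun q - (\<Sum>j<J. term_fun j q)) \<le> U x - (\<Sum>j<J. poly (u j) (Y x))"
proof -
  have q: "q \<in> \<Omega>" unfolding q_def by (rule theta_in_domain[OF assms(1)])
  have sm: "summable (\<lambda>j. term_fun (j + J) q)"
    by (rule summable_ignore_initial_segment[OF summable_term_fun[OF q]])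
  have "log_fun q - (\<Sum>j<J. term_fun j q) = (\<Sum>j. term_fun (j + J) q)"
    unfolding log_fun_def using suminf_minus_initial_segment[OF summable_term_fun[OF q], of J] by simp
  then have "Re (log_fun q - (\<Sum>j<J. term_fun j q)) = (\<Sum>j. Re (term_fun (j + J) q))"
    by (simp only: bounded_linear.suminf[OF bounded_linear_Re sm])
  also have "\<dots> \<le> (\<Sum>j. poly (u (j + J)) (Y x))"
    using Re_term_fun_slice_le[OF assms(1)] sm
    by (intro suminf_le bounded_linear.summable[OF bounded_linear_Re sm] summable_ignore_initial_segment u_summable Y01) (simp_all add: q_def)
  also have "\<dots> = U x - (\<Sum>j<J. poly (u j) (Y x))"
    unfolding U_def by (rule suminf_minus_initial_segment[OF u_summable[OF Y01]])
  finally show ?thesis .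
qed

lemma exp_ln2: "norm (exp (of_real (ln 2) * w)) = 2 powr Re w" for w :: complex
  by (simp add: powr_def mult.commute)

lemma F0_slice_bound: "norm c < 1 \<Longrightarrow> norm (F0 (\<theta> (c *s tor x))) \<le> 2 powr U x"
  using log_fun_tail[of c x 0] theta_in_domain[of c x] by (simp add: F0_def exp_ln2 del: norm_exp_eq_Re)

lemma U_range: "0 \<le> U x" "U x \<le> 1"
  unfolding U_def using u_le_1[OF Y01] suminf_nonneg[OF u_summable[OF Y01] u_nonneg[OF Y01]] by auto

lemma holomorphic_F0: "holomorphic_several F0 \<Omega>"
proof (rule holomorphic_several_cong[OF _ open_theta_domain])
  show "holomorphic_several (\<lambda>q. exp (of_real (ln 2) * log_fun q)) \<Omega>"
    by (intro holomorphic_several_exp holomorphic_several_mult holomorphic_several_const holomorphic_log_fun)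
qed (simp add: F0_def)

lemma F0_Hinf: "F0 \<in> Hinf \<Omega>"
proof (rule HinfI[OF holomorphic_F0])
  have two: "norm (F0 (\<theta> (c *s tor x))) \<le> 2" if "norm c < 1" for c x
  proof -
    have "2 powr U x \<le> 2 powr 1" using U_range by (intro powr_mono) auto
    then show ?thesis using F0_slice_bound[OF that, of x] by simp
  qed
  show "norm (F0 q) \<le> 2" for q
  proof (cases "q \<in> \<Omega>")
    case True
    show ?thesis by (rule polydisc_maximum[OF holomorphic_F0 two True])
  qed (simp add: F0_def)
qed (simp add: F0_def)

lemma Re_term_fun_tendsto:
  assumes "(cis (2 * pi * \<tau>) ^ (CARD('n) * m) * s_fun (\<theta> (tor x))) ^ N j \<noteq> 1"
  shows "((\<lambda>r. Re (term_fun j (\<theta> ((of_real r * cis (2 * pi * \<tau>)) *s tor x)))) \<longlongrightarrow> poly (u j) (Y x)) (at_left 1)"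
proof -
  define w where "w = (\<lambda>r::real. ((of_real r * cis (2 * pi * \<tau>)) ^ (CARD('n) * m) * s_fun (\<theta> (tor x))) ^ N j)"
  have w1: "w 1 \<noteq> 1" using assms by (simp add: w_def)
  have nw1: "norm (w 1) = 1" by (simp add: w_def norm_power norm_mult norm_s_fun_tor)
  have "(w \<longlongrightarrow> w 1) (at_left 1)"
    unfolding w_def by (intro tendsto_intros)
  then have "((\<lambda>r. poly (u j) (Y x) * Re (- 2 * w r / (1 - w r))) \<longlongrightarrow> poly (u j) (Y x) * Re (- 2 * w 1 / (1 - w 1))) (at_left 1)"
    using w1 by (intro tendsto_intros) auto
  moreover have "Re (- 2 * w 1 / (1 - w 1)) = 1" using Re_cayley[OF w1] nw1 by simp
  moreover have "\<forall>\<^sub>F r in at_left 1. Re (term_fun j (\<theta> ((of_real r * cis (2 * pi * \<tau>)) *s tor x))) =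
      poly (u j) (Y x) * Re (- 2 * w r / (1 - w r))"
  proof (rule at_left_radiiI)
    fix r :: real assume "0 < r" "r < 1"
    then have "norm (of_real r * cis (2 * pi * \<tau>)) < 1" by (simp add: norm_mult)
    from term_fun_slice[OF this, of j x]
    have "term_fun j (\<theta> ((of_real r * cis (2 * pi * \<tau>)) *s tor x)) =
        of_real (poly (u j) (Y x)) * (- 2 * w r / (1 - w r))" by (simp only: w_def)
    then show "Re (term_fun j (\<theta> ((of_real r * cis (2 * pi * \<tau>)) *s tor x))) =
      poly (u j) (Y x) * Re (- 2 * w r / (1 - w r))" by (simp only: Re_of_real_times)
  qed
  ultimately show ?thesis by (simp add: tendsto_cong)
qed

text \<open>For each \<open>j\<close> the excluded angles solve a cosine equation and are countable,
  and there are countably many \<open>j\<close>.\<close>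

lemma AE_singular_points:
  "AE \<tau> in lborel. \<forall>j. (cis (2 * pi * \<tau>) ^ (CARD('n) * m) * s_fun (\<theta> (tor x))) ^ N j \<noteq> 1"
  unfolding AE_all_countable
proof
  fix j
  define \<alpha> where "\<alpha> = Arg (s_fun (\<theta> (tor x)))"
  have s: "s_fun (\<theta> (tor x)) = cis \<alpha>"
    using rcis_cmod_Arg[of "s_fun (\<theta> (tor x))"] by (simp add: rcis_def norm_s_fun_tor \<alpha>_def)
  define \<beta> where "\<beta> = real (N j) * (real (CARD('n) * m) * (2 * pi))"
  have "\<beta> \<noteq> 0" using N_pos[of j] m card by (simp add: \<beta>_def)
  have eq: "(cis (2 * pi * \<tau>) ^ (CARD('n) * m) * s_fun (\<theta> (tor x))) ^ N j = cis (N j * \<alpha> + \<beta> * \<tau>)" for \<tau>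
    unfolding s \<beta>_def by (simp add: Complex.DeMoivre cis_mult) (simp add: algebra_simps)
  have "AE \<tau> in lborel. cos (N j * \<alpha> + \<beta> * \<tau>) \<noteq> 1"
    by (rule AE_lborel_cos_neq[OF \<open>\<beta> \<noteq> 0\<close>])
  then show "AE \<tau> in lborel. (cis (2 * pi * \<tau>) ^ (CARD('n) * m) * s_fun (\<theta> (tor x))) ^ N j \<noteq> 1"
  proof eventually_elim
    case (elim \<tau>)
    then show ?case unfolding eq by (metis cis.sel(1) one_complex.sel(1))
  qed
qed

text \<open>
  The modulus of the radial limit cannot drop below \<open>2 powr U x\<close>: removing the first \<open>J\<close> factors
  leaves a function with value \<open>1\<close> at the centre of the slice, and the mean value property gives
  a lower bound for the integral of the limit that tends to the upper bound.
\<close>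

lemma F0_radial_modulus:
  assumes lim: "AE \<tau> in lborel. \<exists>l. radial_value F0 (x + \<tau> *\<^sub>R (\<chi> i. 1)) l"
  shows "AE \<tau> in lborel. \<tau> \<in> {0..1} \<longrightarrow>
    (\<forall>l. radial_value F0 (x + \<tau> *\<^sub>R (\<chi> i. 1)) l \<longrightarrow> norm l = 2 powr U x)"
proof -
  define g where "g = (\<lambda>c. F0 (\<theta> (c *s tor x)))"
  have hol: "g holomorphic_on ball 0 1"
    unfolding g_def by (rule holomorphic_slice[OF holomorphic_F0])
  have "AE \<tau> in lborel. \<exists>l. ((\<lambda>r. g (of_real r * cis (2 * pi * \<tau>))) \<longlongrightarrow> l) (at_left 1) \<and> True"
    using lim unfolding radial_value_slice g_def by simp
  from radial_limit_measurable[OF hol this]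
  obtain a where a: "a \<in> borel_measurable lborel"
    "AE \<tau> in lborel. ((\<lambda>r. g (of_real r * cis (2 * pi * \<tau>))) \<longlongrightarrow> a \<tau>) (at_left 1)"
    by auto
  have small: "norm (of_real r * cis (2 * pi * \<tau>)) < 1" if "0 < r" "r < 1" for r \<tau> :: real
    using that by (simp add: norm_mult)
  have a_le: "AE \<tau> in lborel. norm (a \<tau>) \<le> 2 powr U x"
    using a(2)
  proof eventually_elim
    case (elim \<tau>)
    have "\<forall>\<^sub>F r in at_left 1. norm (g (of_real r * cis (2 * pi * \<tau>))) \<le> 2 powr U x"
      unfolding g_def by (rule at_left_radiiI) (rule F0_slice_bound[OF small])
    then show ?case by (rule tendsto_upperbound[OF tendsto_norm[OF elim]]) simp
  qed
  define I where "I = (LINT \<tau>:{0..1}|lborel. norm (a \<tau>))"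
  \<comment> \<open>Dividing out the first \<open>J\<close> factors leaves \<open>G\<close> with
    boundary modulus \<open>norm (a \<tau>) * 2 powr (- ?S)\<close>; the estimate at the centre
    needs only this modulus.\<close>
  have low: "2 powr (\<Sum>j<J. poly (u j) (Y x)) \<le> I" for J
  proof -
    let ?S = "\<Sum>j<J. poly (u j) (Y x)"
    define L where "L = (\<lambda>q. log_fun q - (\<Sum>j<J. term_fun j q))"
    have holL: "holomorphic_several L \<Omega>"
      unfolding L_def by (intro holomorphic_several_diff holomorphic_log_fun holomorphic_several_sum holomorphic_term_fun)
    define G where "G = (\<lambda>c. exp (of_real (ln 2) * L (\<theta> (c *s tor x))))"
    have "(1 - norm (0::complex)) * norm (G 0) \<le> (LINT \<tau>:{0..1}|lborel. norm (a \<tau>) * 2 powr (- ?S))"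
    proof (rule radial_integral_bound)
      show "G holomorphic_on ball 0 1"
        unfolding G_def by (intro holomorphic_intros holomorphic_slice[OF holL])
      show "norm (G c) \<le> 2 powr (U x - ?S)" if "c \<in> ball 0 1" for c
        using log_fun_tail[of c x J] that by (simp add: G_def L_def exp_ln2 del: norm_exp_eq_Re)
      show "AE \<tau> in lborel. ((\<lambda>r. norm (G (of_real r * cis (2 * pi * \<tau>)))) \<longlongrightarrow> norm (a \<tau>) * 2 powr (- ?S)) (at_left 1)"
        using a(2) AE_singular_points[of x]
      proof eventually_elim
        case (elim \<tau>)
        let ?q = "\<lambda>r. \<theta> ((of_real r * cis (2 * pi * \<tau>)) *s tor x)"
        have "((\<lambda>r. norm (g (of_real r * cis (2 * pi * \<tau>))) * 2 powr (- (\<Sum>j<J. Re (term_fun j (?q r)))))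
            \<longlongrightarrow> norm (a \<tau>) * 2 powr (- ?S)) (at_left 1)"
          using elim by (intro tendsto_intros Re_term_fun_tendsto) auto
        moreover have "\<forall>\<^sub>F r in at_left 1. norm (G (of_real r * cis (2 * pi * \<tau>))) =
            norm (g (of_real r * cis (2 * pi * \<tau>))) * 2 powr (- (\<Sum>j<J. Re (term_fun j (?q r))))"
          by (rule at_left_radiiI)
             (simp add: G_def g_def F0_def L_def theta_in_domain[OF small] exp_ln2 powr_add[symmetric] del: norm_exp_eq_Re)
        ultimately show ?case by (simp add: tendsto_cong)
      qed
      show "(\<lambda>\<tau>. norm (a \<tau>) * 2 powr (- ?S)) \<in> borel_measurable lborel" using a(1) by measurable
    qed simp
    \<comment> \<open>At \<open>c = 0\<close> the argument \<open>w\<close> of the Cayley factor is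
      0, since all exponents are positive.\<close>
    moreover have "term_fun j (\<theta> (0 *s tor x)) = 0" for j
      using N_pos[of j] m card by (subst term_fun_slice) (auto simp: power_0_left)
    then have "G 0 = 1" by (simp add: G_def L_def log_fun_def)
    ultimately have "1 \<le> I * 2 powr (- ?S)"
      by (simp add: I_def)
    then show ?thesis by (simp add: powr_minus field_simps)
  qed
  have "(\<lambda>J. 2 powr (\<Sum>j<J. poly (u j) (Y x))) \<longlonglongrightarrow> 2 powr U x"
    unfolding U_def by (intro tendsto_intros summable_LIMSEQ u_summable Y01) auto
  then have I: "2 powr U x \<le> I"
    by (rule LIMSEQ_le_const2) (use low in auto)
  \<comment> \<open>A function nonnegative almost everywhere whose integral is at most 0 vanishes
    almost everywhere.\<close>
  let ?d = "\<lambda>\<tau>. indicat_real {0..1::real} \<tau> *\<^sub>R (2 powr U x - norm (a \<tau>))"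
  have i1: "integrable lborel (\<lambda>\<tau>. indicat_real {0..1::real} \<tau> *\<^sub>R 2 powr U x)"
    by (intro integrable_scaleR_left) (simp add: integrable_indicator_iff)
  have i2: "integrable lborel (\<lambda>\<tau>. indicat_real {0..1::real} \<tau> *\<^sub>R norm (a \<tau>))"
  proof (rule Bochner_Integration.integrable_bound[OF i1])
    show "(\<lambda>\<tau>. indicat_real {0..1::real} \<tau> *\<^sub>R norm (a \<tau>)) \<in> borel_measurable lborel"
      using a(1) by measurable
    show "AE \<tau> in lborel. norm (indicat_real {0..1} \<tau> *\<^sub>R norm (a \<tau>)) \<le> norm (indicat_real {0..1} \<tau> *\<^sub>R 2 powr U x)"
      using a_le by eventually_elim (simp add: indicator_def)
  qed
  have d_eq: "?d = (\<lambda>\<tau>. indicat_real {0..1} \<tau> *\<^sub>R 2 powr U x - indicat_real {0..1} \<tau> *\<^sub>R norm (a \<tau>))"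
    by (simp add: fun_eq_iff algebra_simps)
  have id: "integrable lborel ?d"
    unfolding d_eq using i1 i2 by (rule Bochner_Integration.integrable_diff)
  have d0: "AE \<tau> in lborel. 0 \<le> ?d \<tau>"
    using a_le by eventually_elim (simp add: indicator_def)
  have "integral\<^sup>L lborel ?d = 2 powr U x - I"
    unfolding d_eq I_def set_lebesgue_integral_def
    by (subst Bochner_Integration.integral_diff[OF i1 i2]) simp
  then have "integral\<^sup>L lborel ?d = 0"
    using I integral_nonneg_AE[OF d0] by simp
  then have "AE \<tau> in lborel. ?d \<tau> = 0"
    using integral_nonneg_eq_0_iff_AE[OF id d0] by blast
  then show ?thesis
    using a(2)
  proof eventually_elim
    case (elim \<tau>)
    show ?case
    proof (intro impI allI)
      fix l assume "\<tau> \<in> {0..1}" and l: "radial_value F0 (x + \<tau> *\<^sub>R (\<chi> i. 1)) l"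
      then have "norm (a \<tau>) = 2 powr U x" using elim(1) by simp
      moreover have "l = a \<tau>"
        using l elim(2) unfolding radial_value_slice g_def by (rule tendsto_unique[rotated]) simp
      ultimately show "norm l = 2 powr U x" by simp
    qed
  qed
qed

text \<open>The function \<open>F\<close> below has boundary modulus within 1/4 of
  \<open>4 - (norm a)\<^sup>2\<close>. The dense slices force \<open>norm F \<le> 5 / 4\<close>
  inside the domain, whereas points with \<open>U x \<le> 1 / 10\<close> would give a boundary
  modulus of at least 7/4.\<close>

lemma F0_not_conj_alg:
  assumes dense: "\<And>W. open W \<Longrightarrow> W \<noteq> {} \<Longrightarrow> \<exists>W'\<subseteq>W. open W' \<and> W' \<noteq> {} \<and> (\<forall>x\<in>W'. U x \<ge> 9 / 10)"
    and small: "\<not> (AE x in lborel. U x > 1 / 10)"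
  shows "F0 \<notin> conj_alg"
proof
  assume "F0 \<in> conj_alg"
  then obtain G h where Gh: "G \<in> Hinf \<Omega>" "h \<in> Hinf \<Omega>" and AE: "AE x in lborel. conj_mult F0 G h (1 / 8) x"
    by (rule conj_algE[of F0 "1 / 8"]) auto
  define F where "F = (\<lambda>z. 4 * G z - F0 z * h z)"
  have F: "F \<in> Hinf \<Omega>"
    unfolding F_def using Gh F0_Hinf by (intro Hinf_diff Hinf_mult Hinf_scale)
  have F_hol: "holomorphic_several F \<Omega>" using F by (simp add: Hinf_def)
  obtain M where M: "M > 0" "\<And>z. norm (F z) \<le> M" using Hinf_bounded[OF F] by blast
  \<comment> \<open>The error 1/8 is multiplied by \<open>norm a \<le> 2\<close>.\<close>
  have diff: "norm ((4 * b - a * c) - b * of_real (4 - (norm a)\<^sup>2)) \<le> 1 / 4"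
    if "norm a \<le> 2" "norm (c - b * cnj a) \<le> 1 / 8" for a b c :: complex
  proof -
    have "(4 * b - a * c) - b * of_real (4 - (norm a)\<^sup>2) = - (a * (c - b * cnj a))"
      unfolding of_real_diff complex_norm_square by (simp add: algebra_simps)
    then have "norm ((4 * b - a * c) - b * of_real (4 - (norm a)\<^sup>2)) = norm a * norm (c - b * cnj a)"
      by (simp only: norm_minus_cancel norm_mult)
    also have "\<dots> \<le> 2 * (1 / 8)" using that by (intro mult_mono) auto
    finally show ?thesis by simp
  qed
  have a2: "norm a \<le> 2 powr U x" if "radial_value F0 x a" for a x
    using F0_slice_bound[of "of_real _" x] by (intro radial_value_bound[OF that]) simp
  have U2: "2 powr U x \<le> 2" for x using powr_mono[of "U x" 1 2] U_range by simp
  have val: "radial_value F x (4 * b - a * c)"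
    if "radial_value F0 x a" "radial_value G x b" "radial_value h x c" for x a b c
    unfolding F_def using that by (intro radial_value_diff radial_value_mult radial_value_scale)
  have slices: "AE x in lborel. AE \<tau> in lborel. conj_mult F0 G h (1 / 8) (x + \<tau> *\<^sub>R (\<chi> i. 1))"
    using AE_lborel_lines[OF AE] .
  have slice: "norm (F (\<theta> (c *s tor x))) \<le> 5 / 4"
    if good: "AE \<tau> in lborel. conj_mult F0 G h (1 / 8) (x + \<tau> *\<^sub>R (\<chi> i. 1))"
      and U: "U x \<ge> 9 / 10" and c: "norm c < 1" for x c
  proof (rule radial_limits_bound[where g = "\<lambda>c. F (\<theta> (c *s tor x))"])
    show "(\<lambda>c. F (\<theta> (c *s tor x))) holomorphic_on ball 0 1" by (rule holomorphic_slice[OF F_hol])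
    show "norm (F (\<theta> (c *s tor x))) \<le> M" for c by (rule M)
    have "AE \<tau> in lborel. \<exists>l. radial_value F0 (x + \<tau> *\<^sub>R (\<chi> i. 1)) l"
      using good by eventually_elim (auto simp: conj_mult_def)
    from F0_radial_modulus[OF this] good
    show "AE \<tau> in lborel. \<exists>l. ((\<lambda>r. F (\<theta> ((of_real r * cis (2 * pi * \<tau>)) *s tor x))) \<longlongrightarrow> l) (at_left 1) \<and>
        (\<tau> \<in> {0..1} \<longrightarrow> norm l \<le> 5 / 4)"
    proof eventually_elim
      case (elim \<tau>)
      let ?x = "x + \<tau> *\<^sub>R (\<chi> i. 1)"
      obtain a b c where v: "radial_value F0 ?x a" "radial_value G ?x b" "radial_value h ?x c"
        "norm b = 1" "norm (c - b * cnj a) \<le> 1 / 8" using elim(2) unfolding conj_mult_def by blast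
      have "norm (4 * b - a * c) \<le> 5 / 4" if "\<tau> \<in> {0..1}"
      proof -
        have na: "norm a = 2 powr U x" using elim(1) that v(1) by blast
        have "2 powr (9 / 10) \<le> norm a" unfolding na using U by (intro powr_mono) auto
        then have "(2 powr (9 / 10))\<^sup>2 \<le> (norm a)\<^sup>2" by (intro power_mono) auto
        \<comment> \<open>By tenth powers this is \<open>3 ^ 10 \<le> 4 ^ 9\<close>, that is
          \<open>59049 \<le> 262144\<close>.\<close>
        moreover have "3 \<le> ((2::real) powr (9 / 10))\<^sup>2"
        proof -
          have "((4::real) powr (9 / 10)) ^ 10 = 4 powr 9"
            by (simp add: powr_power)
          also have "\<dots> = 4 ^ 9" by (rule powr_numeral) simp
          finally have "(3::real) ^ 10 \<le> (4 powr (9 / 10)) ^ 10" by simp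
          moreover have "(3::real) ^ 10 \<le> (4 powr (9 / 10)) ^ 10 \<longleftrightarrow> 3 \<le> (4::real) powr (9 / 10)"
            by (rule power_mono_iff) simp_all
          ultimately have "3 \<le> (4::real) powr (9 / 10)" by blast
          also have "(4::real) powr (9 / 10) = (2 * 2) powr (9 / 10)" by simp
          also have "\<dots> = 2 powr (9 / 10) * 2 powr (9 / 10)" by (rule powr_mult)
          also have "\<dots> = (2 powr (9 / 10))\<^sup>2" by (rule power2_eq_square[symmetric])
          finally show ?thesis .
        qed
        ultimately have "3 \<le> (norm a)\<^sup>2" by linarith
        moreover have "(norm a)\<^sup>2 \<le> 2\<^sup>2" using na U2 by (intro power_mono) auto
        ultimately have "norm (b * of_real (4 - (norm a)\<^sup>2)) \<le> 1"
          by (simp add: norm_mult v(4) del: of_real_diff)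
        moreover have "norm ((4 * b - a * c) - b * of_real (4 - (norm a)\<^sup>2)) \<le> 1 / 4"
          using na U2 v(5) by (intro diff) auto
        ultimately show ?thesis
          using norm_triangle_sub[of "4 * b - a * c" "b * of_real (4 - (norm a)\<^sup>2)"] by linarith
      qed
      then show ?case using val[OF v(1-3)] unfolding radial_value_slice by blast
    qed
  qed (rule c)
  have bound: "norm (F (\<theta> (of_real r *s tor x))) \<le> 5 / 4" if r: "0 < r" "r < 1" for r x
  proof (rule ccontr)
    assume gt: "\<not> norm (F (\<theta> (of_real r *s tor x))) \<le> 5 / 4"
    have cont: "continuous_on UNIV (\<lambda>x. F (\<theta> (of_real r *s tor x)))"
    proof (rule continuous_on_compose2[OF holomorphic_several_imp_continuous_on[OF F_hol]])
      have "continuous_on UNIV (\<lambda>x. of_real r *s tor x)"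
        unfolding vector_scalar_mult_def tor_def by (intro continuous_intros)
      then show "continuous_on UNIV (\<lambda>x. \<theta> (of_real r *s tor x))"
        by (rule continuous_on_compose2[OF continuous_theta[of UNIV]]) auto
    qed (use r radial_in_domain in auto)
    \<comment> \<open>The angles violating the bound at radius \<open>r\<close> form an open set.
      Density gives an open part with \<open>U \<ge> 9 / 10\<close>, and almost every point there
      lies on a good slice, where the bound holds.\<close>
    define W where "W = {x. 5 / 4 < norm (F (\<theta> (of_real r *s tor x)))}"
    have "open W" unfolding W_def by (intro open_Collect_less continuous_intros cont)
    moreover have "W \<noteq> {}" using gt by (auto simp: W_def not_le)
    ultimately obtain W' where W': "W' \<subseteq> W" "open W'" "W' \<noteq> {}" "\<And>x. x \<in> W' \<Longrightarrow> U x \<ge> 9 / 10"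
      using dense by metis
    obtain x where x: "x \<in> W'" "AE \<tau> in lborel. conj_mult F0 G h (1 / 8) (x + \<tau> *\<^sub>R (\<chi> i. 1))"
      by (rule AE_lborel_open_ex[OF slices W'(2,3)])
    have "norm (F (\<theta> (of_real r *s tor x))) \<le> 5 / 4"
      using r by (intro slice x W') simp
    then show False using x(1) W'(1) by (auto simp: W_def)
  qed
  have "AE x in lborel. U x > 1 / 10"
    using AE
  proof eventually_elim
    case (elim x)
    obtain a b c where v: "radial_value F0 x a" "radial_value G x b" "radial_value h x c"
      "norm b = 1" "norm (c - b * cnj a) \<le> 1 / 8" using elim unfolding conj_mult_def by blast
    show ?case
    proof (rule ccontr)
      assume "\<not> U x > 1 / 10"
      \<comment> \<open>The exponent 1/2 is a convenient weaker bound: it yields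
        \<open>(norm a)\<^sup>2 \<le> 2\<close>, which suffices for the contradiction.\<close>
      then have "2 powr U x \<le> 2 powr (1 / 2)" by (intro powr_mono) auto
      then have "norm a \<le> 2 powr (1 / 2)" using a2[OF v(1)] by linarith
      then have "(norm a)\<^sup>2 \<le> (2 powr (1 / 2))\<^sup>2" by (intro power_mono) auto
      also have "(2 powr (1 / 2))\<^sup>2 = (2::real)" by (simp add: powr_half_sqrt)
      finally have na: "(norm a)\<^sup>2 \<le> 2" .
      have "norm (4 * b - a * c) \<le> 5 / 4"
        by (rule radial_value_bound[OF val[OF v(1-3)] bound])
      moreover have "norm ((4 * b - a * c) - b * of_real (4 - (norm a)\<^sup>2)) \<le> 1 / 4"
        using a2[OF v(1)] U2[of x] v(5) by (intro diff) auto
      moreover have "2 \<le> norm (b * of_real (4 - (norm a)\<^sup>2))"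
        using na by (simp add: norm_mult v(4) del: of_real_diff)
      ultimately show False
        using norm_triangle_sub[of "b * of_real (4 - (norm a)\<^sup>2)" "4 * b - a * c"]
        by (simp add: norm_minus_commute)
    qed
  qed
  then show False using small by blast
qed

end

theorem theoremA:
  fixes ix :: "'n::finite \<Rightarrow> nat" and m t :: nat
  assumes "CARD('n) > 1"
    and "bij_betw ix UNIV {1..CARD('n)}"
    and "m > 0" and "t > 0" and "t dvd m"
  defines "\<Omega> \<equiv> theta_domain ix m t"
  shows "Hinf_subalgebra \<Omega> (closed_algebra_generated \<Omega> (inner_functions ix m t))
       \<and> closed_algebra_generated \<Omega> (inner_functions ix m t) \<subset> Hinf \<Omega>"
proof -
  interpret theta_map ix m t
    using assms(1-5) by unfold_locales
  obtain u :: "nat \<Rightarrow> real poly"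
    where u: "\<And>j y. y \<in> {0..1} \<Longrightarrow> 0 \<le> poly (u j) y"
      "\<And>y. y \<in> {0..1} \<Longrightarrow> summable (\<lambda>j. poly (u j) y)"
      "\<And>y. y \<in> {0..1} \<Longrightarrow> (\<Sum>j. poly (u j) y) \<le> 1"
    and dense: "\<And>W. open W \<Longrightarrow> W \<noteq> {} \<Longrightarrow> \<exists>W'\<subseteq>W. open W' \<and> W' \<noteq> {} \<and> (\<forall>x\<in>W'. (\<Sum>j. poly (u j) (Y x)) \<ge> 9 / 10)"
    and small: "\<not> (AE x in lborel. (\<Sum>j. poly (u j) (Y x)) > 1 / 10)"
    by (rule plateau_series_exists[of Y]) (use Y_range continuous_Y AE_Y_neq in auto)
  interpret plateau_series ix m t u
    using u by unfold_locales
  \<comment> \<open>The class \<open>conj_alg\<close> contains the generated algebra, so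
    \<open>F0\<close> witnesses that the inclusion is proper.\<close>
  have "F0 \<notin> conj_alg"
    using dense small by (intro F0_not_conj_alg) (simp_all add: U_def)
  moreover have "inner_functions ix m t \<subseteq> Hinf \<Omega>"
    using inner_functions_radial(1) unfolding \<Omega>_def by blast
  then have sub: "Hinf_subalgebra \<Omega> (closed_algebra_generated \<Omega> (inner_functions ix m t))"
    unfolding \<Omega>_def by (intro Hinf_subalgebra_closed_algebra_generated open_theta_domain)
  ultimately show ?thesis
    using F0_Hinf closed_algebra_generated_inner_subset unfolding \<Omega>_def Hinf_subalgebra_def by blast
qed

end
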